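(* (a) There exists a single-source single-sink upward outerplanar DAG with stack number $3$. (b) There exists an upward outerplanar DAG with stack number $4$. (c) There exists an upward planar $3$-tree with stack number $5$.
   Context: A vertex order of a DAG $G=(V,E)$ is a total order of $V$ with $u$ before $v$ for every edge $(u,v)$. Two vertex-disjoint edges $(a,b),(c,d)$ cross in a vertex order $\sigma$ if $a<_\sigma c<_\sigma b<_\sigma d$. A $k$-stack layout is a vertex order plus a partition of $E$ into $k$ sets with no two crossing edges in a set; the stack number is the least such $k$. An outerplanar DAG is a DAG whose underlying undirected graph is outerplanar; a DAG is upward (planar) if it admits a planar drawing where every edge is a curve strictly increasing in $y$ from tail to head; an upward outerplanar DAG is an outerplanar DAG that is upward planar. Single-source (single-sink) means exactly one vertex of in-degree (out-degree) $0$. A planar $3$-tree is obtained from a triangle by repeatedly inserting a vertex into a bounded triangular face and joining it to the face's three vertices; an upward planar $3$-tree is an upward planar DAG whose underlying graph is a planar $3$-tree. *)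

theory Defs
  imports "HOL-Analysis.Analysis" "HOL-Library.Disjoint_Sets" "Graph_Theory.Pair_Digraph"
begin

text \<open>The locale \<^locale>\<open>pair_digraph\<close> describes a finite loop-free digraph whose arcs are pairs of vertices
  (hence without parallel arcs).\<close>

definition dag :: "'a pair_pre_digraph \<Rightarrow> bool" where
  "dag G \<longleftrightarrow> pair_digraph G \<and> acyclic (parcs G)"

definition single_source :: "'a pair_pre_digraph \<Rightarrow> bool" where
  "single_source G \<longleftrightarrow> (\<exists>!v. v \<in> pverts G \<and> in_degree (with_proj G) v = 0)"

definition single_sink :: "'a pair_pre_digraph \<Rightarrow> bool" where
  "single_sink G \<longleftrightarrow> (\<exists>!v. v \<in> pverts G \<and> out_degree (with_proj G) v = 0)"


section \<open>Stack layouts\<close>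

text \<open>A vertex order is given by its reflexive relation; \<open>before\<close> is the strict part.\<close>

definition before :: "'a rel \<Rightarrow> 'a \<Rightarrow> 'a \<Rightarrow> bool" where
  "before r u v \<longleftrightarrow> (u, v) \<in> r \<and> u \<noteq> v"

definition vertex_order :: "'a pair_pre_digraph \<Rightarrow> 'a rel \<Rightarrow> bool" where
  "vertex_order G r \<longleftrightarrow> linear_order_on (pverts G) r \<and> (\<forall>(u, v) \<in> parcs G. before r u v)"

definition crosses :: "'a rel \<Rightarrow> 'a \<times> 'a \<Rightarrow> 'a \<times> 'a \<Rightarrow> bool" where
  "crosses r = (\<lambda>(a, b) (c, d).
     {a, b} \<inter> {c, d} = {} \<and> before r a c \<and> before r c b \<and> before r b d)"

definition stack_layout :: "'a pair_pre_digraph \<Rightarrow> nat \<Rightarrow> 'a rel \<Rightarrow> 'a rel set \<Rightarrow> bool" where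
  "stack_layout G k r P \<longleftrightarrow>
     vertex_order G r \<and> partition_on (parcs G) P \<and> finite P \<and> card P = k \<and>
     (\<forall>S \<in> P. \<forall>e \<in> S. \<forall>f \<in> S. \<not> crosses r e f)"

definition stack_number :: "'a pair_pre_digraph \<Rightarrow> nat" where
  "stack_number G = (LEAST k. \<exists>r P. stack_layout G k r P)"


section \<open>Planar drawings\<close>

text \<open>An undirected graph is given by its vertex set and its set of two-element edges.\<close>

definition underlying_edges :: "'a pair_pre_digraph \<Rightarrow> 'a set set" where
  "underlying_edges G = (\<lambda>(u, v). {u, v}) ` parcs G"

text \<open>The plane is \<^typ>\<open>complex\<close>. Vertices lie at \<open>p\<close>, and the edge \<open>e\<close> is drawn as the
  simple curve \<open>\<gamma> e\<close>.\<close>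

definition planar_drawing ::
  "'a set \<Rightarrow> 'a set set \<Rightarrow> ('a \<Rightarrow> complex) \<Rightarrow> ('a set \<Rightarrow> real \<Rightarrow> complex) \<Rightarrow> bool" where
  "planar_drawing V E p \<gamma> \<longleftrightarrow>
     inj_on p V \<and>
     (\<forall>e \<in> E. arc (\<gamma> e) \<and> {pathstart (\<gamma> e), pathfinish (\<gamma> e)} = p ` e \<and>
        path_image (\<gamma> e) \<inter> p ` V \<subseteq> p ` e) \<and>
     (\<forall>e \<in> E. \<forall>f \<in> E. e \<noteq> f \<longrightarrow> path_image (\<gamma> e) \<inter> path_image (\<gamma> f) \<subseteq> p ` (e \<inter> f))"

definition drawing_image ::
  "'a set \<Rightarrow> 'a set set \<Rightarrow> ('a \<Rightarrow> complex) \<Rightarrow> ('a set \<Rightarrow> real \<Rightarrow> complex) \<Rightarrow> complex set" where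
  "drawing_image V E p \<gamma> = p ` V \<union> (\<Union>e \<in> E. path_image (\<gamma> e))"

text \<open>For a finite graph the image is compact, so \<^const>\<open>outside\<close> of it is the unbounded face.\<close>

definition outerplanar :: "'a set \<Rightarrow> 'a set set \<Rightarrow> bool" where
  "outerplanar V E \<longleftrightarrow>
     (\<exists>p \<gamma>. planar_drawing V E p \<gamma> \<and>
        (\<forall>v \<in> V. p v \<in> frontier (outside (drawing_image V E p \<gamma>))))"

definition outerplanar_dag :: "'a pair_pre_digraph \<Rightarrow> bool" where
  "outerplanar_dag G \<longleftrightarrow> dag G \<and> outerplanar (pverts G) (underlying_edges G)"

definition upward_planar_dag :: "'a pair_pre_digraph \<Rightarrow> bool" where
  "upward_planar_dag G \<longleftrightarrow> dag G \<and>
     (\<exists>p \<gamma>. planar_drawing (pverts G) (underlying_edges G) p \<gamma> \<and>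
        (\<forall>(u, v) \<in> parcs G.
           pathstart (\<gamma> {u, v}) = p u \<and> pathfinish (\<gamma> {u, v}) = p v \<and>
           strict_mono_on {0..1} (\<lambda>t. Im (\<gamma> {u, v} t))))"

definition upward_outerplanar_dag :: "'a pair_pre_digraph \<Rightarrow> bool" where
  "upward_outerplanar_dag G \<longleftrightarrow> outerplanar_dag G \<and> upward_planar_dag G"


section \<open>Planar 3-trees\<close>

text \<open>In \<open>planar_3_tree_faces V E F\<close> the set \<open>F\<close> contains the bounded faces, each given by its three
  corners. The corners determine a bounded face, because every face created by an insertion
  has the new vertex as a corner.\<close>

inductive planar_3_tree_faces :: "'a set \<Rightarrow> 'a set set \<Rightarrow> 'a set set \<Rightarrow> bool" where
  triangle: "a \<noteq> b \<Longrightarrow> b \<noteq> c \<Longrightarrow> a \<noteq> c \<Longrightarrow>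
    planar_3_tree_faces {a, b, c} {{a, b}, {b, c}, {a, c}} {{a, b, c}}"
| insertion: "planar_3_tree_faces V E F \<Longrightarrow> {a, b, c} \<in> F \<Longrightarrow>
    a \<noteq> b \<Longrightarrow> b \<noteq> c \<Longrightarrow> a \<noteq> c \<Longrightarrow> x \<notin> V \<Longrightarrow>
    planar_3_tree_faces (insert x V) (E \<union> {{x, a}, {x, b}, {x, c}})
      (F - {{a, b, c}} \<union> {{x, a, b}, {x, b, c}, {x, a, c}})"

definition planar_3_tree :: "'a set \<Rightarrow> 'a set set \<Rightarrow> bool" where
  "planar_3_tree V E \<longleftrightarrow> (\<exists>F. planar_3_tree_faces V E F)"

definition upward_planar_3_tree :: "'a pair_pre_digraph \<Rightarrow> bool" where
  "upward_planar_3_tree G \<longleftrightarrow>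
     upward_planar_dag G \<and> planar_3_tree (pverts G) (underlying_edges G)"

end

theory Submission
  imports Defs
begin

text \<open>A \<open>k\<close>-stack layout is a vertex order with a colouring of the arcs in which crossing arcs get different
  colours. For fixed small graphs, the absence of a layout is a propositional statement about the order of
  pairs of vertices and the colours of arcs, refuted from few instances of transitivity and of the crossing
  condition. The two outerplanar graphs come with a layout that attains the bound, with a
  straight-line drawing on the integer lattice for upward planarity, and with a straight-line drawing on
  the parabola \<open>y = x\<^sup>2\<close> for outerplanarity.
  For the planar 3-tree neither is given: inserting a vertex into a face raises the stack number by at most
  one, so that among the successive subtrees of a 3-tree without a 4-stack layout one has stack
  number exactly 5, and the drawing extends because the new vertex can be placed at a
  suitable height inside the triangle.\<close>

section \<open>Stackable digraphs\<close>

text \<open>A refutation may use any selection of conditions that every layout satisfies, so an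
  unsatisfiable core is enough, and an arc may even be allowed to lie in several stacks, since
  crossings are excluded in each stack separately. What makes the search large is the renaming of
  stacks, which \<open>canonical_colouring\<close> breaks. The witness of (c) is never named: it is
  a tree of the insertion sequence that has no 4-stack layout although its predecessor has one. The
  step from one tree to the next costs at most one stack because every face is transitively
  oriented: its corners with an arc into the new vertex have arcs to its corners with an arc from
  it, hence precede them in each vertex order, and the new vertex fits in between. Drawings survive
  the same step because both positions relative to the middle corner are available inside every
  triangle, however flat it is.\<close>

text \<open>Unlike \<^const>\<open>stack_layout\<close>, this allows unused stacks and is therefore monotone in \<open>k\<close>.\<close>

definition stackable :: "'a pair_pre_digraph \<Rightarrow> nat \<Rightarrow> bool" where
  "stackable G k \<longleftrightarrow> (\<exists>r c. vertex_order G r \<and> c ` parcs G \<subseteq> {..<k} \<and>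
     (\<forall>e \<in> parcs G. \<forall>f \<in> parcs G. crosses r e f \<longrightarrow> c e \<noteq> c f))"

lemma stackable_mono: "stackable G j \<Longrightarrow> j \<le> k \<Longrightarrow> stackable G k"
  unfolding stackable_def by (meson lessThan_subset_iff subset_trans)

lemma stack_layout_imp_stackable:
  assumes "stack_layout G k r P"
  shows "stackable G k"
proof -
  have part: "partition_on (parcs G) P" and "finite P" "card P = k"
    and nc: "\<And>S e f. S \<in> P \<Longrightarrow> e \<in> S \<Longrightarrow> f \<in> S \<Longrightarrow> \<not> crosses r e f"
    and "vertex_order G r"
    using assms by (auto simp: stack_layout_def)
  then obtain h where h: "bij_betw h P {..<k}"
    by (metis bij_betw_iff_card card_lessThan finite_lessThan)
  \<comment> \<open>Blocks are disjoint, so \<open>THE\<close> picks the block of an arc; the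
    bijection \<open>h\<close> turns this block into a colour.\<close>
  define c where "c = (\<lambda>e. h (THE S. S \<in> P \<and> e \<in> S))"
  have c: "c e = h S" if "S \<in> P" "e \<in> S" for e S
  proof -
    have "(THE S. S \<in> P \<and> e \<in> S) = S"
      using that part by (intro the_equality) (auto dest: partition_onD2 disjointD)
    then show ?thesis by (simp add: c_def)
  qed
  have block: "\<exists>S\<in>P. e \<in> S" if "e \<in> parcs G" for e
    using that partition_onD1[OF part] by auto
  have "c ` parcs G \<subseteq> {..<k}"
    using block c h bij_betwE by fastforce
  moreover have "c e \<noteq> c f" if "e \<in> parcs G" "f \<in> parcs G" "crosses r e f" for e f
    using block[OF that(1)] block[OF that(2)] c nc that(3) h
    by (metis bij_betw_def inj_on_def)
  ultimately show ?thesis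
    using \<open>vertex_order G r\<close> unfolding stackable_def by blast
qed

text \<open>Blocks of a partition are nonempty, so only the colours in use yield blocks. This is why
  \<open>j\<close> may be smaller than \<open>k\<close>.\<close>

lemma stackable_imp_stack_layout:
  assumes "stackable G k"
  obtains j r P where "j \<le> k" "stack_layout G j r P"
proof -
  obtain r c where r: "vertex_order G r" and c: "c ` parcs G \<subseteq> {..<k}"
    and nc: "\<And>e f. e \<in> parcs G \<Longrightarrow> f \<in> parcs G \<Longrightarrow> crosses r e f \<Longrightarrow> c e \<noteq> c f"
    using assms by (auto simp: stackable_def)
  define P where "P = (\<lambda>i. {e \<in> parcs G. c e = i}) ` (c ` parcs G)"
  have "finite (c ` parcs G)" "card (c ` parcs G) \<le> k"
    using c finite_subset card_mono[OF _ c] by auto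
  then have "finite P" "card P \<le> k"
    unfolding P_def using card_image_le order_trans by blast+
  moreover have "partition_on (parcs G) P"
    by (rule partition_onI) (auto simp: P_def disjnt_def)
  moreover have "\<not> crosses r e f" if "S \<in> P" "e \<in> S" "f \<in> S" for S e f
  proof -
    obtain i where "S = {e \<in> parcs G. c e = i}" using \<open>S \<in> P\<close> unfolding P_def by blast
    then show ?thesis using that(2,3) nc[of e f] by auto
  qed
  ultimately have "stack_layout G (card P) r P"
    using r unfolding stack_layout_def by blast
  with \<open>card P \<le> k\<close> that show thesis by blast
qed

text \<open>A layout with fewer than \<open>Suc k\<close> blocks would make \<open>G\<close>
  stackable with \<open>k\<close> by monotonicity; hence the layout obtained from the first
  assumption has exactly \<open>Suc k\<close> blocks.\<close>

lemma stack_number_eqI: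
  assumes "stackable G (Suc k)" "\<not> stackable G k"
  shows "stack_number G = Suc k"
proof -
  obtain j r P where "j \<le> Suc k" "stack_layout G j r P"
    using stackable_imp_stack_layout[OF assms(1)] .
  moreover have lb: "Suc k \<le> i" if "stack_layout G i r P" for i r P
    using stack_layout_imp_stackable[OF that] assms(2) stackable_mono not_less_eq_eq by blast
  ultimately show ?thesis
    unfolding stack_number_def by (intro Least_equality) (auto, metis le_antisym)
qed

text \<open>The new arcs share the vertex \<open>x\<close>, so one extra stack takes all of them.\<close>

lemma stackable_insert_vertex:
  assumes "stackable \<lparr>pverts = V, parcs = A\<rparr> k" "A \<subseteq> V \<times> V" "x \<notin> V"
    and In: "In \<subseteq> V" and Out: "Out \<subseteq> V" and io: "In \<times> Out \<subseteq> A"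
  shows "stackable \<lparr>pverts = insert x V, parcs = A \<union> (In \<times> {x} \<union> {x} \<times> Out)\<rparr> (Suc k)"
proof -
  let ?B = "In \<times> {x} \<union> {x} \<times> Out"
  obtain r c where lin: "linear_order_on V r" and A: "\<And>u v. (u, v) \<in> A \<Longrightarrow> before r u v"
    and c: "c ` A \<subseteq> {..<k}"
    and nc: "\<And>e f. e \<in> A \<Longrightarrow> f \<in> A \<Longrightarrow> crosses r e f \<Longrightarrow> c e \<noteq> c f"
    using assms(1) unfolding stackable_def vertex_order_def by clarsimp blast
  have refl: "\<And>v. v \<in> V \<Longrightarrow> (v, v) \<in> r" and sub: "r \<subseteq> V \<times> V" and trans: "trans r"
    and antisym: "antisym r" and total: "total_on V r"
    using lin by (auto simp: linear_order_on_def partial_order_on_def preorder_on_def refl_on_def)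
  \<comment> \<open>The initial segment of the order that ends with the last in-neighbour of
    \<open>x\<close>; it is empty if there is none. \<open>x\<close> goes directly behind
    it.\<close>
  define D where "D = {w \<in> V. \<exists>u \<in> In. (w, u) \<in> r}"
  define r' where "r' = r \<union> D \<times> {x} \<union> {x} \<times> (V - D) \<union> {(x, x)}"
  define c' where "c' = (\<lambda>e. if e \<in> A then c e else k)"
  have D: "(w, v) \<in> r \<Longrightarrow> v \<in> D \<Longrightarrow> w \<in> D" for v w
    unfolding D_def using trans sub by (auto dest: transD)
  have DV: "D \<subseteq> V" by (auto simp: D_def)
  have cut: "(p, s) \<in> r" if "p \<in> D" "s \<in> V" "s \<notin> D" for p s
    using that D DV total by (metis subsetD total_on_def)
  have "linear_order_on (insert x V) r'"
    unfolding linear_order_on_def partial_order_on_def preorder_on_def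
  proof (intro conjI)
    show "refl_on (insert x V) r'"
      using refl by (auto simp: refl_on_def r'_def)
    show "r' \<subseteq> insert x V \<times> insert x V"
      using sub by (auto simp: r'_def D_def)
    show "trans r'"
    proof (rule transI)
      fix p q s assume "(p, q) \<in> r'" "(q, s) \<in> r'"
      then show "(p, s) \<in> r'"
        using trans D DV cut sub \<open>x \<notin> V\<close> unfolding r'_def by (auto dest: transD)
    qed
    show "antisym r'"
      using antisym sub \<open>x \<notin> V\<close> unfolding r'_def antisym_def D_def by auto
    show "total_on (insert x V) r'"
      using total unfolding r'_def total_on_def D_def by auto
  qed
  moreover have "before r' u v" if "(u, v) \<in> A \<union> ?B" for u v
  proof -
    \<comment> \<open>The arcs \<open>In \<times> Out\<close> put each in-neighbour before each
      out-neighbour, so the cut separates them.\<close>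
    have "w \<notin> D" if "w \<in> Out" for w
    proof
      assume "w \<in> D"
      then obtain u where "u \<in> In" "(w, u) \<in> r" by (auto simp: D_def)
      then have "before r u w" using io that A by auto
      then show False using antisym \<open>(w, u) \<in> r\<close> by (auto simp: before_def antisym_def)
    qed
    moreover have "In \<subseteq> D" using In refl by (auto simp: D_def)
    ultimately show ?thesis
      using that A In Out DV \<open>x \<notin> V\<close> by (auto simp: before_def r'_def)
  qed
  moreover have "c' ` (A \<union> ?B) \<subseteq> {..<Suc k}"
    using c by (auto simp: c'_def less_Suc_eq)
  moreover have "c' e \<noteq> c' f" if e: "e \<in> A \<union> ?B" and f: "f \<in> A \<union> ?B" and cr: "crosses r' e f" for e f
  proof (cases "e \<in> A \<and> f \<in> A")
    case True
    have "before r u v" if "before r' u v" "u \<in> V" "v \<in> V" for u v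
      using that \<open>x \<notin> V\<close> by (auto simp: before_def r'_def)
    then have "crosses r e f"
      using cr True assms(2) unfolding crosses_def by fastforce
    then show ?thesis using nc True by (simp add: c'_def)
  next
    case False
    have "\<not> (e \<in> ?B \<and> f \<in> ?B)"
      using cr unfolding crosses_def by auto
    then consider "e \<in> A" "f \<notin> A" | "f \<in> A" "e \<notin> A" using False e f by blast
    then show ?thesis using c by cases (auto simp: c'_def)
  qed
  ultimately show ?thesis
    unfolding stackable_def vertex_order_def by (intro exI[of _ r'] exI[of _ c']) auto
qed

text \<open>The vertex order is the order of the numbers, which turns both conditions into
  comparisons that evaluation can decide.\<close>

lemma stackableI:
  fixes n :: nat
  assumes arcs: "list_all (\<lambda>(u, v). u < v \<and> v < n) (concat Ss)"
    and nc: "list_all (\<lambda>S. list_all (\<lambda>(a, b). list_all (\<lambda>(c, d). \<not> (a < c \<and> c < b \<and> b < d)) S) S) Ss"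
  shows "stackable \<lparr>pverts = {..<n}, parcs = set (concat Ss)\<rparr> (length Ss)"
proof -
  define r where "r = {(u, v). u \<le> v \<and> v < n}"
  \<comment> \<open>Should an arc occur in several lists, any choice is sound, because the check
    covers each whole list.\<close>
  define c where "c e = (LEAST i. i < length Ss \<and> e \<in> set (Ss ! i))" for e
  have c: "c e < length Ss" "e \<in> set (Ss ! c e)" if e: "e \<in> set (concat Ss)" for e
  proof -
    obtain S where S: "S \<in> set Ss" "e \<in> set S" using e by auto
    obtain i where "i < length Ss" "Ss ! i = S" using S(1) by (auto simp: in_set_conv_nth)
    then have "i < length Ss \<and> e \<in> set (Ss ! i)" using S(2) by simp
    then have "c e < length Ss \<and> e \<in> set (Ss ! c e)" unfolding c_def by (rule LeastI)
    then show "c e < length Ss" "e \<in> set (Ss ! c e)" by auto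
  qed
  have "linear_order_on {..<n} r"
    unfolding linear_order_on_def partial_order_on_def preorder_on_def
  proof (intro conjI)
    show "total_on {..<n} r" by (auto simp: total_on_def r_def)
    show "trans r" by (rule transI) (auto simp: r_def)
    show "antisym r" by (rule antisymI) (auto simp: r_def)
  qed (auto simp: refl_on_def r_def)
  moreover have "before r u v" if "(u, v) \<in> set (concat Ss)" for u v
    using arcs[unfolded list_all_iff, rule_format, OF that] by (auto simp: before_def r_def)
  moreover have "c (a, b) \<noteq> c (x, d)"
    if ab: "(a, b) \<in> set (concat Ss)" and xd: "(x, d) \<in> set (concat Ss)" and cr: "crosses r (a, b) (x, d)" for a b x d
  proof
    assume eq: "c (a, b) = c (x, d)"
    have "a < x" "x < b" "b < d" using cr by (auto simp: crosses_def before_def r_def)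
    moreover have "Ss ! c (a, b) \<in> set Ss" using c(1)[OF ab] by simp
    ultimately show False
      using nc c(2)[OF ab] c(2)[OF xd] unfolding list_all_iff eq by blast
  qed
  ultimately show ?thesis
    using c(1) unfolding stackable_def vertex_order_def by (intro exI[of _ r] exI[of _ c]) (auto simp del: set_concat)
qed

section \<open>Propositional encoding of stack layouts\<close>

text \<open>Symmetry breaking, arc by arc: if the colour of the next arc exceeds the number
  \<open>n\<close> of earlier ones, exchange it with colour \<open>n\<close>. The earlier arcs have
  colours below \<open>n\<close> and are not affected, and \<open>n\<close> lies below a colour in
  use, hence below \<open>k\<close>.\<close>

lemma canonical_colouring:
  fixes c :: "'b \<Rightarrow> nat"
  assumes "c ` A \<subseteq> {..<k}" "set es \<subseteq> A"
  shows "\<exists>c'. c' ` A \<subseteq> {..<k} \<and> (\<forall>e f. c' e = c' f \<longleftrightarrow> c e = c f) \<and> (\<forall>i<length es. c' (es ! i) \<le> i)"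
  using assms(2)
proof (induction es rule: rev_induct)
  case Nil
  then show ?case using assms(1) by auto
next
  case (snoc e es)
  let ?n = "length es"
  obtain c' where c': "c' ` A \<subseteq> {..<k}" "\<And>e f. c' e = c' f \<longleftrightarrow> c e = c f"
    "\<And>i. i < ?n \<Longrightarrow> c' (es ! i) \<le> i"
    using snoc by auto
  show ?case
  proof (cases "c' e \<le> ?n")
    case True
    then show ?thesis using c' by (intro exI[of _ c']) (auto simp: nth_append less_Suc_eq)
  next
    case False
    define d where "d = (\<lambda>f. if c' f = c' e then ?n else if c' f = ?n then c' e else c' f)"
    have "c' e < k" using c'(1) snoc.prems by auto
    then have "d ` A \<subseteq> {..<k}" using c'(1) False by (auto simp: d_def)
    moreover have "d f = d g \<longleftrightarrow> c f = c g" for f g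
      using c'(2)[of f g] by (auto simp: d_def)
    moreover have "d ((es @ [e]) ! i) \<le> i" if "i < length (es @ [e])" for i
      using that c'(3)[of i] False by (auto simp: d_def nth_append less_Suc_eq)
    ultimately show ?thesis by blast
  qed
qed

text \<open>\<open>C u v i\<close> states that the arc \<open>(u, v)\<close> lies in stack \<open>i\<close>. The stacks are numbered so that the
  \<open>i\<close>-th arc of \<open>es\<close> lies in a stack \<open>\<le> i\<close>.\<close>

lemma stackable_propositions:
  assumes "stackable \<lparr>pverts = V, parcs = A\<rparr> k" "set es \<subseteq> A"
  obtains p C where
    "\<And>u v. u \<in> V \<Longrightarrow> v \<in> V \<Longrightarrow> u \<noteq> v \<Longrightarrow> p u v \<longleftrightarrow> \<not> p v u"
    "\<And>u v w. \<not> p u v \<or> \<not> p v w \<or> p u w"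
    "\<And>u v. (u, v) \<in> A \<Longrightarrow> p u v"
    "\<And>u v. (u, v) \<in> A \<Longrightarrow> \<exists>i<k. C u v i"
    "\<And>a b c d i. \<not> C a b i \<or> \<not> C c d i \<or> \<not> p a c \<or> \<not> p c b \<or> \<not> p b d"
    "\<And>u v i j. i < length es \<Longrightarrow> es ! i = (u, v) \<Longrightarrow> C u v j \<Longrightarrow> j \<le> i"
proof -
  obtain r c where lin: "linear_order_on V r" and A: "\<And>u v. (u, v) \<in> A \<Longrightarrow> before r u v"
    and c: "c ` A \<subseteq> {..<k}"
    and nc: "\<And>e f. e \<in> A \<Longrightarrow> f \<in> A \<Longrightarrow> crosses r e f \<Longrightarrow> c e \<noteq> c f"
    using assms(1) unfolding stackable_def vertex_order_def by clarsimp blast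
  have antisym: "antisym r" and trans: "trans r" and total: "total_on V r"
    using lin by (auto simp: linear_order_on_def partial_order_on_def preorder_on_def)
  have asym: "\<not> (before r u v \<and> before r v u)" for u v
    using antisym by (auto simp: before_def antisym_def)
  have tr: "before r u w" if "before r u v" "before r v w" for u v w
    using that asym[of u v] trans by (auto simp: before_def dest: transD)
  obtain c' where c': "c' ` A \<subseteq> {..<k}" "\<And>e f. c' e = c' f \<longleftrightarrow> c e = c f"
    "\<And>i. i < length es \<Longrightarrow> c' (es ! i) \<le> i"
    using canonical_colouring[OF c assms(2)] by blast
  show thesis
  \<comment> \<open>Membership in \<open>A\<close> is part of \<open>C\<close>, so the crossing
    condition holds for arbitrary vertices and need not be guarded.\<close>
  proof (rule that[of "before r" "\<lambda>u v i. (u, v) \<in> A \<and> c' (u, v) = i"])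
    show "before r u v \<longleftrightarrow> \<not> before r v u" if "u \<in> V" "v \<in> V" "u \<noteq> v" for u v
      using that total asym[of u v] by (auto simp: before_def total_on_def)
    show "\<not> ((a, b) \<in> A \<and> c' (a, b) = i) \<or> \<not> ((x, d) \<in> A \<and> c' (x, d) = i) \<or>
      \<not> before r a x \<or> \<not> before r x b \<or> \<not> before r b d" for a b x d i
    proof (rule ccontr)
      assume *: "\<not> ?thesis"
      \<comment> \<open>The three comparisons already make the vertices distinct, as
        \<open>crosses\<close> demands.\<close>
      then have "before r a b" "before r a d" "before r x d" using tr by blast+
      with * have "crosses r (a, b) (x, d)"
        by (auto simp: crosses_def before_def)
      then show False using nc[of "(a, b)" "(x, d)"] c'(2)[of "(a, b)" "(x, d)"] * by auto
    qed
    show "j \<le> i" if "i < length es" "es ! i = (u, v)" "(u, v) \<in> A \<and> c' (u, v) = j" for u v i j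
      using c'(3)[OF that(1)] that by simp
  qed (use A tr c'(1) in auto)
qed

text \<open>Refutes a layout with \<open>k\<close> stacks by propositional reasoning about the order \<open>p\<close> and the stacks:
  \<open>ts\<close> and \<open>qs\<close> select the instances of transitivity and of the crossing condition to be used.\<close>

lemma not_stackableI:
  assumes es: "list_all (\<lambda>e. e \<in> set A) es" and ks: "set ks = {..<k}"
    and unsat: "\<And>p C. (\<And>u v. u < v \<Longrightarrow> v < n \<Longrightarrow> p v u \<longleftrightarrow> \<not> p u v) \<Longrightarrow>
      list_all (\<lambda>(u, v). p u v) A \<Longrightarrow>
      list_all (\<lambda>(u, v). list_ex (C u v) ks) A \<Longrightarrow>
      list_all (\<lambda>(i, u, v). list_all (\<lambda>j. j \<le> i \<or> \<not> C u v j) ks) (List.enumerate 0 es) \<Longrightarrow>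
      list_all (\<lambda>(u, v, w). \<not> p u v \<or> \<not> p v w \<or> p u w) ts \<Longrightarrow>
      list_all (\<lambda>(a, b, c, d). list_all (\<lambda>i.
        \<not> C a b i \<or> \<not> C c d i \<or> \<not> p a c \<or> \<not> p c b \<or> \<not> p b d) ks) qs \<Longrightarrow> False"
  shows "\<not> stackable \<lparr>pverts = {..<n :: nat}, parcs = set A\<rparr> k"
proof
  assume "stackable \<lparr>pverts = {..<n}, parcs = set A\<rparr> k"
  moreover have "set es \<subseteq> set A" using es by (auto simp: list_all_iff)
  ultimately obtain p C where
    total: "\<And>u v. u \<in> {..<n} \<Longrightarrow> v \<in> {..<n} \<Longrightarrow> u \<noteq> v \<Longrightarrow> p u v \<longleftrightarrow> \<not> p v u"
    and trans: "\<And>u v w. \<not> p u v \<or> \<not> p v w \<or> p u w"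
    and arc: "\<And>u v. (u, v) \<in> set A \<Longrightarrow> p u v"
    and stack: "\<And>u v. (u, v) \<in> set A \<Longrightarrow> \<exists>i<k. C u v i"
    and cross: "\<And>a b c d i. \<not> C a b i \<or> \<not> C c d i \<or> \<not> p a c \<or> \<not> p c b \<or> \<not> p b d"
    and first: "\<And>u v i j. i < length es \<Longrightarrow> es ! i = (u, v) \<Longrightarrow> C u v j \<Longrightarrow> j \<le> i"
    by (rule stackable_propositions) (rule that; assumption)
  show False
  proof (rule unsat)
    show "p v u \<longleftrightarrow> \<not> p u v" if "u < v" "v < n" for u v
      using total[of u v] that by auto
    show "list_all (\<lambda>(u, v). p u v) A"
      using arc by (auto simp: list_all_iff)
    show "list_all (\<lambda>(u, v). list_ex (C u v) ks) A"
      unfolding list_all_iff list_ex_iff ks using stack by auto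
    show "list_all (\<lambda>(i, u, v). list_all (\<lambda>j. j \<le> i \<or> \<not> C u v j) ks) (List.enumerate 0 es)"
      using first by (auto simp: list_all_iff in_set_enumerate_eq)
    show "list_all (\<lambda>(u, v, w). \<not> p u v \<or> \<not> p v w \<or> p u w) ts"
      unfolding list_all_iff split_def by (intro ballI trans)
    show "list_all (\<lambda>(a, b, c, d). list_all (\<lambda>i.
        \<not> C a b i \<or> \<not> C c d i \<or> \<not> p a c \<or> \<not> p c b \<or> \<not> p b d) ks) qs"
      unfolding list_all_iff split_def by (intro ballI cross)
  qed
qed

section \<open>Straight-line drawings\<close>

text \<open>The determinant of two plane vectors: \<open>cross_prod (b - a) (c - a)\<close> is twice
  the signed area of the triangle \<open>a b c\<close>.\<close>

definition cross_prod :: "complex \<Rightarrow> complex \<Rightarrow> real" where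
  "cross_prod u v = Re u * Im v - Im u * Re v"

definition noncollinear :: "complex \<Rightarrow> complex \<Rightarrow> complex \<Rightarrow> bool" where
  "noncollinear a b c \<longleftrightarrow> cross_prod (b - a) (c - a) \<noteq> 0"

lemma noncollinear_commute:
  "noncollinear b a c \<longleftrightarrow> noncollinear a b c" "noncollinear a c b \<longleftrightarrow> noncollinear a b c"
  by (auto simp: noncollinear_def cross_prod_def algebra_simps)

lemma noncollinear_imp_not_collinear: "noncollinear a b c \<Longrightarrow> \<not> collinear {a, b, c}"
proof
  assume "noncollinear a b c" "collinear {a, b, c}"
  then obtain u s t where "b - a = s *\<^sub>R u" "c - a = t *\<^sub>R u"
    unfolding collinear_def by blast
  then have "cross_prod (b - a) (c - a) = 0"
    by (simp add: cross_prod_def)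
  with \<open>noncollinear a b c\<close> show False by (simp add: noncollinear_def)
qed

text \<open>Eliminating the first coordinate leaves a linear system in the differences of the other
  two, whose determinant is the cross product; Cramer's rule makes both vanish.\<close>

lemma barycentric_unique:
  assumes "noncollinear a b c" "\<alpha> + \<beta> + \<gamma> = \<alpha>' + \<beta>' + \<gamma>'"
    and eq: "\<alpha> *\<^sub>R a + \<beta> *\<^sub>R b + \<gamma> *\<^sub>R c = \<alpha>' *\<^sub>R a + \<beta>' *\<^sub>R b + \<gamma>' *\<^sub>R c"
  shows "\<alpha> = \<alpha>' \<and> \<beta> = \<beta>' \<and> \<gamma> = \<gamma>'"
proof -
  have \<alpha>: "\<alpha> = \<alpha>' + (\<beta>' - \<beta>) + (\<gamma>' - \<gamma>)" using assms(2) by simp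
  have 0: "(\<beta> - \<beta>') * Re (b - a) + (\<gamma> - \<gamma>') * Re (c - a) = 0"
    "(\<beta> - \<beta>') * Im (b - a) + (\<gamma> - \<gamma>') * Im (c - a) = 0"
    using eq unfolding \<alpha> by (auto simp: complex_eq_iff algebra_simps)
  have "(\<beta> - \<beta>') * cross_prod (b - a) (c - a) = 0" "(\<gamma> - \<gamma>') * cross_prod (b - a) (c - a) = 0"
    using 0 unfolding cross_prod_def by algebra+
  then show ?thesis
    using assms(1,2) by (auto simp: noncollinear_def)
qed

text \<open>The interior of a nondegenerate triangle (see \<open>interior_triangle\<close>) in
  coordinates, so that inclusions and disjointness become linear arithmetic.\<close>

definition open_triangle :: "complex \<Rightarrow> complex \<Rightarrow> complex \<Rightarrow> complex set" where
  "open_triangle a b c = {\<alpha> *\<^sub>R a + \<beta> *\<^sub>R b + \<gamma> *\<^sub>R c |\<alpha> \<beta> \<gamma>. 0 < \<alpha> \<and> 0 < \<beta> \<and> 0 < \<gamma> \<and> \<alpha> + \<beta> + \<gamma> = 1}"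

lemma open_triangleI:
  "0 < \<alpha> \<Longrightarrow> 0 < \<beta> \<Longrightarrow> 0 < \<gamma> \<Longrightarrow> \<alpha> + \<beta> + \<gamma> = 1 \<Longrightarrow>
    \<alpha> *\<^sub>R a + \<beta> *\<^sub>R b + \<gamma> *\<^sub>R c \<in> open_triangle a b c"
  unfolding open_triangle_def by blast

lemma open_triangle_commute:
  "open_triangle b a c = open_triangle a b c" "open_triangle a c b = open_triangle a b c"
proof -
  have "open_triangle b a c \<subseteq> open_triangle a b c" for a b c
  proof
    fix q assume "q \<in> open_triangle b a c"
    then obtain \<alpha> \<beta> \<gamma> where "0 < \<alpha>" "0 < \<beta>" "0 < \<gamma>" "\<alpha> + \<beta> + \<gamma> = 1" "q = \<alpha> *\<^sub>R b + \<beta> *\<^sub>R a + \<gamma> *\<^sub>R c"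
      by (auto simp: open_triangle_def)
    then show "q \<in> open_triangle a b c"
      using open_triangleI[of \<beta> \<alpha> \<gamma> a b c] by (simp add: add_ac)
  qed
  then show "open_triangle b a c = open_triangle a b c" by blast
  have "open_triangle a c b \<subseteq> open_triangle a b c" for a b c
  proof
    fix q assume "q \<in> open_triangle a c b"
    then obtain \<alpha> \<beta> \<gamma> where "0 < \<alpha>" "0 < \<beta>" "0 < \<gamma>" "\<alpha> + \<beta> + \<gamma> = 1" "q = \<alpha> *\<^sub>R a + \<beta> *\<^sub>R c + \<gamma> *\<^sub>R b"
      by (auto simp: open_triangle_def)
    then show "q \<in> open_triangle a b c"
      using open_triangleI[of \<alpha> \<gamma> \<beta> a b c] by (simp add: add_ac)
  qed
  then show "open_triangle a c b = open_triangle a b c" by blast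
qed

lemma interior_triangle:
  assumes "noncollinear a b c"
  shows "interior (convex hull {a, b, c}) = open_triangle a b c"
  using interior_convex_hull_3_minimal[OF noncollinear_imp_not_collinear[OF assms]]
  unfolding open_triangle_def by (auto 0 3)

context
  fixes a b c z :: complex
  assumes nc: "noncollinear a b c" and z: "z \<in> open_triangle a b c"
begin

text \<open>The three triangles \<open>z b c\<close>, \<open>a z c\<close>, \<open>a b z\<close> tile the triangle \<open>a b c\<close>, so every
  point of it has exactly one representation of the following form.\<close>

lemma star_unique:
  assumes "l *\<^sub>R z + s *\<^sub>R a + t *\<^sub>R b + u *\<^sub>R c = l' *\<^sub>R z + s' *\<^sub>R a + t' *\<^sub>R b + u' *\<^sub>R c"
    and sum: "l + s + t + u = 1" "l' + s' + t' + u' = 1"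
    and nonneg: "s \<ge> 0" "t \<ge> 0" "u \<ge> 0" "s' \<ge> 0" "t' \<ge> 0" "u' \<ge> 0"
    and zero: "s = 0 \<or> t = 0 \<or> u = 0" "s' = 0 \<or> t' = 0 \<or> u' = 0"
  shows "l = l' \<and> s = s' \<and> t = t' \<and> u = u'"
proof -
  obtain \<alpha> \<beta> \<gamma> where pos: "0 < \<alpha>" "0 < \<beta>" "0 < \<gamma>" and 1: "\<alpha> + \<beta> + \<gamma> = 1"
    and z: "z = \<alpha> *\<^sub>R a + \<beta> *\<^sub>R b + \<gamma> *\<^sub>R c"
    using z by (auto simp: open_triangle_def)
  have \<gamma>: "\<gamma> = 1 - \<alpha> - \<beta>" using 1 by simp
  have "(l * \<alpha> + s) *\<^sub>R a + (l * \<beta> + t) *\<^sub>R b + (l * \<gamma> + u) *\<^sub>R c =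
    (l' * \<alpha> + s') *\<^sub>R a + (l' * \<beta> + t') *\<^sub>R b + (l' * \<gamma> + u') *\<^sub>R c"
    using assms(1) unfolding z by (simp add: algebra_simps)
  moreover have "(l * \<alpha> + s) + (l * \<beta> + t) + (l * \<gamma> + u) = (l' * \<alpha> + s') + (l' * \<beta> + t') + (l' * \<gamma> + u')"
    using sum unfolding \<gamma> by (simp add: algebra_simps)
  ultimately have eq: "l * \<alpha> + s = l' * \<alpha> + s'" "l * \<beta> + t = l' * \<beta> + t'" "l * \<gamma> + u = l' * \<gamma> + u'"
    using barycentric_unique[OF nc] by blast+
  \<comment> \<open>If \<open>l < l'\<close>, then each coordinate equation gives
    \<open>s > s'\<close>, \<open>t > t'\<close> and \<open>u > u'\<close>, so none of
    \<open>s\<close>, \<open>t\<close>, \<open>u\<close> vanishes, against \<open>zero\<close>. The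
    other case is symmetric.\<close>
  have "l = l'"
  proof (rule ccontr)
    assume "l \<noteq> l'"
    then consider "l < l'" | "l' < l" by linarith
    then show False
    proof cases
      case 1
      then have "l * \<alpha> < l' * \<alpha>" "l * \<beta> < l' * \<beta>" "l * \<gamma> < l' * \<gamma>" using pos by auto
      then show ?thesis using eq nonneg zero by linarith
    next
      case 2
      then have "l' * \<alpha> < l * \<alpha>" "l' * \<beta> < l * \<beta>" "l' * \<gamma> < l * \<gamma>" using pos by auto
      then show ?thesis using eq nonneg zero by linarith
    qed
  qed
  then show ?thesis using eq by auto
qed

text \<open>Replacing a corner by \<open>z\<close> multiplies the area by the barycentric coordinate
  of \<open>z\<close> at that corner.\<close>

lemma noncollinear_star: "noncollinear z b c"
proof -
  obtain \<alpha> \<beta> \<gamma> where "0 < \<alpha>" and 1: "\<alpha> + \<beta> + \<gamma> = 1" and z: "z = \<alpha> *\<^sub>R a + \<beta> *\<^sub>R b + \<gamma> *\<^sub>R c"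
    using z by (auto simp: open_triangle_def)
  have \<gamma>: "\<gamma> = 1 - \<alpha> - \<beta>" using 1 by simp
  have "cross_prod (b - z) (c - z) = \<alpha> * cross_prod (b - a) (c - a)"
    unfolding z \<gamma> cross_prod_def by (simp add: algebra_simps)
  then show ?thesis using \<open>0 < \<alpha>\<close> nc by (simp add: noncollinear_def)
qed

lemma star_triangle_subset: "open_triangle z b c \<subseteq> open_triangle a b c"
proof
  fix q assume "q \<in> open_triangle z b c"
  then obtain l t u where "0 < l" "0 < t" "0 < u" "l + t + u = 1" and q: "q = l *\<^sub>R z + t *\<^sub>R b + u *\<^sub>R c"
    by (auto simp: open_triangle_def)
  moreover obtain \<alpha> \<beta> \<gamma> where "0 < \<alpha>" "0 < \<beta>" "0 < \<gamma>" "\<alpha> + \<beta> + \<gamma> = 1" and z: "z = \<alpha> *\<^sub>R a + \<beta> *\<^sub>R b + \<gamma> *\<^sub>R c"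
    using z by (auto simp: open_triangle_def)
  moreover from this have "l * \<alpha> + l * \<beta> + l * \<gamma> = l" by (metis distrib_left mult.right_neutral)
  moreover have q': "q = (l * \<alpha>) *\<^sub>R a + (l * \<beta> + t) *\<^sub>R b + (l * \<gamma> + u) *\<^sub>R c"
    unfolding q z by (simp add: algebra_simps)
  ultimately show "q \<in> open_triangle a b c"
    unfolding q' by (intro open_triangleI) (auto intro!: add_pos_pos)
qed

lemma star_segment_subset: "closed_segment z a \<subseteq> insert a (open_triangle a b c)"
proof
  fix q assume "q \<in> closed_segment z a"
  then obtain l where l: "0 \<le> l" "l \<le> 1" and q: "q = (1 - l) *\<^sub>R z + l *\<^sub>R a"
    by (auto simp: closed_segment_def)
  obtain \<alpha> \<beta> \<gamma> where pos: "0 < \<alpha>" "0 < \<beta>" "0 < \<gamma>" and 1: "\<alpha> + \<beta> + \<gamma> = 1" and z: "z = \<alpha> *\<^sub>R a + \<beta> *\<^sub>R b + \<gamma> *\<^sub>R c"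
    using z by (auto simp: open_triangle_def)
  show "q \<in> insert a (open_triangle a b c)"
  proof (cases "l = 1")
    case False
    then have "0 < 1 - l" using l by simp
    have "(1 - l) * \<alpha> + (1 - l) * \<beta> + (1 - l) * \<gamma> = 1 - l" using 1 by (metis distrib_left mult.right_neutral)
    moreover have q': "q = ((1 - l) * \<alpha> + l) *\<^sub>R a + ((1 - l) * \<beta>) *\<^sub>R b + ((1 - l) * \<gamma>) *\<^sub>R c"
      unfolding q z by (simp add: algebra_simps)
    ultimately have "q \<in> open_triangle a b c"
      unfolding q' using \<open>0 < 1 - l\<close> pos l by (intro open_triangleI) (auto intro!: add_pos_nonneg)
    then show ?thesis by simp
  qed (use q in simp)
qed

text \<open>Here and in the next two lemmas, the sets differ in which coordinates of
  \<open>star_unique\<close> can be nonzero; by uniqueness a common point would have both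
  supports.\<close>

lemma star_segments_disjoint: "closed_segment z a \<inter> closed_segment z b \<subseteq> {z}"
proof
  fix q assume "q \<in> closed_segment z a \<inter> closed_segment z b"
  then obtain l m where "0 \<le> l" "q = (1 - l) *\<^sub>R z + l *\<^sub>R a" "0 \<le> m" "q = (1 - m) *\<^sub>R z + m *\<^sub>R b"
    by (auto simp: closed_segment_def)
  then show "q \<in> {z}"
    using star_unique[of "1 - l" l 0 0 "1 - m" 0 m 0] by auto
qed

lemma star_triangle_segment_disjoint:
  "open_triangle z b c \<inter> closed_segment z a = {}" "open_triangle z b c \<inter> closed_segment z b = {}"
proof -
  show "open_triangle z b c \<inter> closed_segment z a = {}"
  proof (rule ccontr)
    assume "\<not> ?thesis"
    then obtain l t u m where "0 < l" "0 < t" "0 < u" "l + t + u = 1" "0 \<le> m"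
      "l *\<^sub>R z + t *\<^sub>R b + u *\<^sub>R c = (1 - m) *\<^sub>R z + m *\<^sub>R a"
      by (fastforce simp: open_triangle_def closed_segment_def)
    then show False
      using star_unique[of l 0 t u "1 - m" m 0 0] by auto
  qed
  show "open_triangle z b c \<inter> closed_segment z b = {}"
  proof (rule ccontr)
    assume "\<not> ?thesis"
    then obtain l t u m where "0 < l" "0 < t" "0 < u" "l + t + u = 1" "0 \<le> m"
      "l *\<^sub>R z + t *\<^sub>R b + u *\<^sub>R c = (1 - m) *\<^sub>R z + m *\<^sub>R b"
      by (fastforce simp: open_triangle_def closed_segment_def)
    then show False
      using star_unique[of l 0 t u "1 - m" 0 m 0] by auto
  qed
qed

lemma star_triangles_disjoint: "open_triangle z b c \<inter> open_triangle z a c = {}"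
proof (rule ccontr)
  assume "\<not> ?thesis"
  then obtain l t u l' s' u' where "0 < l" "0 < t" "0 < u" "l + t + u = 1" 
     "0 < l'" "0 < s'" "0 < u'" "l' + s' + u' = 1"
    "l *\<^sub>R z + t *\<^sub>R b + u *\<^sub>R c = l' *\<^sub>R z + s' *\<^sub>R a + u' *\<^sub>R c"
    by (fastforce simp: open_triangle_def)
  then show False
    using star_unique[of l 0 t u l' s' 0 u'] by auto
qed

end

lemma triangle_segments:
  assumes nc: "noncollinear a b c"
  shows "closed_segment a b \<inter> closed_segment a c \<subseteq> {a}" "open_triangle a b c \<inter> closed_segment a b = {}"
proof
  fix q assume "q \<in> closed_segment a b \<inter> closed_segment a c"
  then obtain s t where "q = (1 - s) *\<^sub>R a + s *\<^sub>R b" "q = (1 - t) *\<^sub>R a + t *\<^sub>R c"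
    unfolding closed_segment_def by blast
  then show "q \<in> {a}"
    using barycentric_unique[OF nc, of "1 - s" s 0 "1 - t" 0 t] by auto
next
  show "open_triangle a b c \<inter> closed_segment a b = {}"
  proof (rule ccontr)
    assume "\<not> ?thesis"
    then obtain q where q: "q \<in> open_triangle a b c" "q \<in> closed_segment a b" by blast
    obtain \<alpha> \<beta> \<gamma> where "\<gamma> > 0" "\<alpha> + \<beta> + \<gamma> = 1" "q = \<alpha> *\<^sub>R a + \<beta> *\<^sub>R b + \<gamma> *\<^sub>R c"
      using q(1) unfolding open_triangle_def by blast
    moreover obtain s where "q = (1 - s) *\<^sub>R a + s *\<^sub>R b"
      using q(2) unfolding closed_segment_def by blast
    ultimately show False
      using barycentric_unique[OF nc, of \<alpha> \<beta> \<gamma> "1 - s" s 0] by auto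
  qed
qed

section \<open>From straight-line drawings to planarity, upwardness and outerplanarity\<close>

text \<open>Edges are hulls of their ends, without direction or parametrisation. \<open>F\<close>
  collects triangles kept empty and interior-disjoint, the invariant under which vertices can be
  inserted; drawings given by coordinates take it empty.\<close>

definition straight_drawing :: "'a set \<Rightarrow> 'a set set \<Rightarrow> 'a set set \<Rightarrow> ('a \<Rightarrow> complex) \<Rightarrow> bool" where
  "straight_drawing V E F p \<longleftrightarrow>
     inj_on p V \<and> \<Union>E \<subseteq> V \<and>
     (\<forall>e \<in> E. convex hull (p ` e) \<inter> p ` V \<subseteq> p ` e) \<and>
     (\<forall>e \<in> E. \<forall>f \<in> E. e \<noteq> f \<longrightarrow> convex hull (p ` e) \<inter> convex hull (p ` f) \<subseteq> p ` (e \<inter> f)) \<and>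
     (\<forall>t \<in> F. \<exists>a b c. t = {a, b, c} \<and> t \<subseteq> V \<and> noncollinear (p a) (p b) (p c)) \<and>
     (\<forall>t \<in> F. interior (convex hull (p ` t)) \<inter> p ` V = {}) \<and>
     (\<forall>t \<in> F. \<forall>e \<in> E. interior (convex hull (p ` t)) \<inter> convex hull (p ` e) = {}) \<and>
     (\<forall>s \<in> F. \<forall>t \<in> F. s \<noteq> t \<longrightarrow> interior (convex hull (p ` s)) \<inter> interior (convex hull (p ` t)) = {})"

text \<open>The direction of each segment is left open: upward planarity needs tail to head,
  outerplanarity takes any.\<close>

lemma straight_drawing_imp_planar_drawing:
  assumes dr: "straight_drawing V E F p"
    and \<gamma>: "\<And>e. e \<in> E \<Longrightarrow> \<exists>u v. e = {u, v} \<and> u \<noteq> v \<and> \<gamma> e = linepath (p u) (p v)"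
  shows "planar_drawing V E p \<gamma>"
proof -
  have inj: "inj_on p V" and EV: "\<Union>E \<subseteq> V" using dr by (auto simp: straight_drawing_def)
  have image: "path_image (\<gamma> e) = convex hull (p ` e)" if e: "e \<in> E" for e
    using \<gamma>[OF e] by (auto simp: segment_convex_hull)
  moreover have "arc (\<gamma> e) \<and> {pathstart (\<gamma> e), pathfinish (\<gamma> e)} = p ` e" if e: "e \<in> E" for e
  proof -
    obtain u v where uv: "e = {u, v}" "u \<noteq> v" "\<gamma> e = linepath (p u) (p v)" using \<gamma>[OF e] by blast
    then have "u \<in> V" "v \<in> V" using EV e by auto
    then have "p u \<noteq> p v" using inj uv(2) by (auto dest: inj_onD)
    then show ?thesis using uv by auto
  qed
  ultimately show ?thesis
    using dr by (simp add: planar_drawing_def straight_drawing_def)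
qed

lemma upward_planar_dagI:
  assumes "finite V" "A \<subseteq> V \<times> V"
    and dr: "straight_drawing V (underlying_edges \<lparr>pverts = V, parcs = A\<rparr>) F p"
    and up: "\<And>u v. (u, v) \<in> A \<Longrightarrow> Im (p u) < Im (p v)"
  shows "upward_planar_dag \<lparr>pverts = V, parcs = A\<rparr>"
proof -
  let ?G = "\<lparr>pverts = V, parcs = A\<rparr>"
  have "finite A" using assms(1,2) by (meson finite_SigmaI finite_subset)
  then have "pair_digraph ?G"
    using assms(1,2) up by unfold_locales (auto, fastforce)
  moreover have "acyclic A"
    \<comment> \<open>The rule expects a measure that decreases along arcs, hence the negated
      height.\<close>
    using up by (intro acyclicI_order[where f = "\<lambda>v. - Im (p v)"]) auto
  ultimately have "dag ?G" by (simp add: dag_def)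
  \<comment> \<open>Curves are indexed by undirected edges, so the direction has to be recovered. It
    is unique because heights exclude opposite arcs.\<close>
  define tail where "tail e = (THE u. \<exists>v. (u, v) \<in> A \<and> e = {u, v})" for e
  define head where "head e = (THE v. \<exists>u. (u, v) \<in> A \<and> e = {u, v})" for e
  have asym: "(v, u) \<notin> A" if "(u, v) \<in> A" for u v
    using up[of u v] up[of v u] that by auto
  have tail: "tail {u, v} = u" and head: "head {u, v} = v" if "(u, v) \<in> A" for u v
    unfolding tail_def head_def using that asym
    by (auto intro!: the_equality simp: doubleton_eq_iff)
  define \<gamma> where "\<gamma> e = linepath (p (tail e)) (p (head e))" for e
  have \<gamma>: "\<gamma> {u, v} = linepath (p u) (p v)" if "(u, v) \<in> A" for u v
    by (simp add: \<gamma>_def tail head that)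
  have "planar_drawing V (underlying_edges ?G) p \<gamma>"
  proof (rule straight_drawing_imp_planar_drawing[OF dr])
    fix e assume "e \<in> underlying_edges ?G"
    then obtain u v where "(u, v) \<in> A" "e = {u, v}" by (auto simp: underlying_edges_def)
    then show "\<exists>u v. e = {u, v} \<and> u \<noteq> v \<and> \<gamma> e = linepath (p u) (p v)"
      using \<gamma> up by blast
  qed
  moreover have "strict_mono_on {0..1} (\<lambda>t. Im (\<gamma> {u, v} t))" if "(u, v) \<in> A" for u v
  proof (rule strict_mono_onI)
    fix s t :: real assume "s < t"
    have "Im (\<gamma> {u, v} r) = Im (p u) + r * (Im (p v) - Im (p u))" for r
      unfolding \<gamma>[OF that] by (simp add: linepath_def algebra_simps)
    then show "Im (\<gamma> {u, v} s) < Im (\<gamma> {u, v} t)"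
      using \<open>s < t\<close> up[OF that] by simp
  qed
  ultimately show ?thesis
    unfolding upward_planar_dag_def using \<open>dag ?G\<close> \<gamma> by (intro conjI exI[of _ p] exI[of _ \<gamma>]) auto
qed

text \<open>Straight drawings on the parabola \<open>y = x\<^sup>2\<close> stay above it, so that the unbounded face contains
  the region below.\<close>

lemma outerplanarI:
  assumes E: "\<And>e. e \<in> E \<Longrightarrow> \<exists>u v. e = {u, v} \<and> u \<noteq> v"
    and dr: "straight_drawing V E F (\<lambda>v. Complex (h v) ((h v)\<^sup>2))"
  shows "outerplanar V E"
proof -
  define p where "p v = Complex (h v) ((h v)\<^sup>2)" for v
  have "\<forall>e\<in>E. \<exists>uv. e = {fst uv, snd uv} \<and> fst uv \<noteq> snd uv"
    using E by (metis fst_conv snd_conv)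
  then obtain g where g: "\<And>e. e \<in> E \<Longrightarrow> e = {fst (g e), snd (g e)} \<and> fst (g e) \<noteq> snd (g e)"
    by (meson bchoice)
  define \<gamma> where "\<gamma> e = linepath (p (fst (g e))) (p (snd (g e)))" for e
  have \<gamma>: "\<exists>u v. e = {u, v} \<and> u \<noteq> v \<and> \<gamma> e = linepath (p u) (p v)" if "e \<in> E" for e
    using g[OF that] unfolding \<gamma>_def by blast
  have planar: "planar_drawing V E p \<gamma>"
    using straight_drawing_imp_planar_drawing[OF dr] \<gamma> unfolding p_def by blast
  let ?D = "drawing_image V E p \<gamma>"
  define above where "above = {z :: complex. (Re z)\<^sup>2 \<le> Im z}"
  have "convex above"
  proof (rule convexI)
    fix x y :: complex and u v :: real
    assume xy: "x \<in> above" "y \<in> above" and uv: "0 \<le> u" "0 \<le> v" "u + v = 1"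
    have "(u * Re x + v * Re y)\<^sup>2 \<le> u * (Re x)\<^sup>2 + v * (Re y)\<^sup>2"
      using convex_power2 uv unfolding convex_on_def by auto
    also have "\<dots> \<le> u * Im x + v * Im y"
      using xy uv by (intro add_mono mult_left_mono) (auto simp: above_def)
    finally show "u *\<^sub>R x + v *\<^sub>R y \<in> above" by (simp add: above_def)
  qed
  have "path_image (\<gamma> e) \<subseteq> above" if e: "e \<in> E" for e
  proof -
    obtain u v where "\<gamma> e = linepath (p u) (p v)" using \<gamma>[OF e] by blast
    then show ?thesis
      using \<open>convex above\<close> by (simp add: closed_segment_subset above_def p_def)
  qed
  then have D: "?D \<subseteq> above"
    unfolding drawing_image_def by (auto simp: above_def p_def)
  \<comment> \<open>The complement of a convex set in the plane has no bounded component, and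
    passing to the smaller set \<open>?D\<close> only enlarges the outside.\<close>
  have below: "- above \<subseteq> outside ?D"
  proof
    fix z assume z: "z \<in> - above"
    have "z \<in> outside above"
      using outside_convex[OF \<open>convex above\<close>] z by blast
    then show "z \<in> outside ?D" using outside_mono[OF D] by blast
  qed
  have "p v \<in> frontier (outside ?D)" if "v \<in> V" for v
  proof -
    have "p v \<in> ?D" using that by (simp add: drawing_image_def)
    then have "p v \<notin> outside ?D" using outside_no_overlap by blast
    then have "p v \<notin> interior (outside ?D)" using interior_subset by blast
    moreover have "p v \<in> closure (outside ?D)"
    proof (rule closure_approachable[THEN iffD2], intro allI impI)
      fix \<epsilon> :: real assume "\<epsilon> > 0"
      \<comment> \<open>Just below a point of the parabola, hence off the region that contains the
        drawing.\<close>
      define q where "q = Complex (h v) ((h v)\<^sup>2 - \<epsilon> / 2)"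
      have "q \<in> outside ?D" using below \<open>\<epsilon> > 0\<close> by (auto simp: above_def q_def)
      moreover have "dist q (p v) < \<epsilon>"
        using \<open>\<epsilon> > 0\<close> by (simp add: q_def p_def dist_norm cmod_def)
      ultimately show "\<exists>y\<in>outside ?D. dist y (p v) < \<epsilon>" by blast
    qed
    ultimately show ?thesis by (simp add: frontier_def)
  qed
  with planar show ?thesis unfolding outerplanar_def by blast
qed

section \<open>Drawings on the integer lattice, verified by evaluation\<close>

text \<open>The signed area over the base \<open>a b\<close> is an affine function of the third
  point. It vanishes on the line through \<open>a\<close> and \<open>b\<close> and has one strict
  sign at both \<open>c\<close> and \<open>d\<close>, hence on their whole segment.\<close>

lemma segments_disjoint:
  assumes "cross_prod (b - a) (c - a) * cross_prod (b - a) (d - a) > 0"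
  shows "closed_segment a b \<inter> closed_segment c d = {}"
proof (rule ccontr)
  let ?g = "\<lambda>q. cross_prod (b - a) (q - a)"
  assume "\<not> ?thesis"
  then obtain q where q: "q \<in> closed_segment a b" "q \<in> closed_segment c d" by blast
  obtain s where s: "q = (1 - s) *\<^sub>R a + s *\<^sub>R b" using q(1) unfolding closed_segment_def by blast
  have "?g q = 0" unfolding s by (simp add: cross_prod_def algebra_simps)
  obtain t where t: "0 \<le> t" "t \<le> 1" "q = (1 - t) *\<^sub>R c + t *\<^sub>R d"
    using q(2) unfolding closed_segment_def by blast
  have g: "?g q = (1 - t) * ?g c + t * ?g d" unfolding t(3) by (simp add: cross_prod_def algebra_simps)
  show False
  proof (cases "?g c > 0")
    case True
    then have "?g d > 0" using assms by (simp add: zero_less_mult_iff)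
    then have "(1 - t) * ?g c + t * ?g d > 0"
      using True t by (cases "t = 0") (simp_all add: add_nonneg_pos)
    then show False using g \<open>?g q = 0\<close> by simp
  next
    case False
    then have "?g c < 0" "?g d < 0" using assms by (auto simp: zero_less_mult_iff)
    then show False using t g \<open>?g q = 0\<close> convex_bound_lt[of "?g c" 0 "?g d" "1 - t" t] by simp
  qed
qed

definition lattice_point :: "(int \<times> int) list \<Rightarrow> nat \<Rightarrow> complex" where
  "lattice_point pts v = Complex (of_int (fst (pts ! v))) (of_int (snd (pts ! v)))"

text \<open>The cross product of \<open>noncollinear\<close>, in integers so that its sign can be
  evaluated.\<close>

definition orientation :: "(int \<times> int) list \<Rightarrow> nat \<Rightarrow> nat \<Rightarrow> nat \<Rightarrow> int" where
  "orientation pts u v w = (fst (pts ! v) - fst (pts ! u)) * (snd (pts ! w) - snd (pts ! u)) -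
     (snd (pts ! v) - snd (pts ! u)) * (fst (pts ! w) - fst (pts ! u))"

lemma cross_prod_lattice_point:
  "cross_prod (lattice_point pts v - lattice_point pts u) (lattice_point pts w - lattice_point pts u) =
    of_int (orientation pts u v w)"
  by (simp add: cross_prod_def lattice_point_def orientation_def)

text \<open>For arcs with a common end, not being collinear suffices. Otherwise one segment has to
  lie strictly on one side of the line through the other. A repeated or reversed arc is rejected,
  because an orientation with a repeated vertex is 0.\<close>

fun separated :: "(int \<times> int) list \<Rightarrow> nat \<times> nat \<Rightarrow> nat \<times> nat \<Rightarrow> bool" where
  "separated pts (u, v) (w, z) \<longleftrightarrow>
     (if u = w then orientation pts u v z \<noteq> 0
      else if u = z then orientation pts u v w \<noteq> 0
      else if v = w then orientation pts v u z \<noteq> 0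
      else if v = z then orientation pts v u w \<noteq> 0
      else orientation pts u v w * orientation pts u v z > 0 \<or>
        orientation pts w z u * orientation pts w z v > 0)"

lemma separated_segments:
  assumes "separated pts (u, v) (w, z)"
  shows "closed_segment (lattice_point pts u) (lattice_point pts v) \<inter>
      closed_segment (lattice_point pts w) (lattice_point pts z) \<subseteq> lattice_point pts ` ({u, v} \<inter> {w, z})"
proof -
  let ?p = "lattice_point pts"
  have common: "closed_segment (?p a) (?p b) \<inter> closed_segment (?p a) (?p c) \<subseteq> {?p a}"
    if "orientation pts a b c \<noteq> 0" for a b c
    using that by (intro triangle_segments) (simp add: noncollinear_def cross_prod_lattice_point)
  have disj: "closed_segment (?p a) (?p b) \<inter> closed_segment (?p c) (?p d) = {}"
    if "orientation pts a b c * orientation pts a b d > 0" for a b c d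
    using that by (intro segments_disjoint) (simp add: cross_prod_lattice_point flip: of_int_mult)
  consider "u = w" "orientation pts u v z \<noteq> 0" | "u = z" "orientation pts u v w \<noteq> 0"
    | "v = w" "orientation pts v u z \<noteq> 0" | "v = z" "orientation pts v u w \<noteq> 0"
    | "orientation pts u v w * orientation pts u v z > 0" | "orientation pts w z u * orientation pts w z v > 0"
    using assms by (auto split: if_splits)
  then show ?thesis
  proof cases
    case 1
    then show ?thesis using common[of u v z] by auto
  next
    case 2
    then show ?thesis
      unfolding closed_segment_commute[of "?p w" "?p z"] using common[of u v w] by auto
  next
    case 3
    then show ?thesis
      unfolding closed_segment_commute[of "?p u" "?p v"] using common[of v u z] by auto
  next
    case 4
    then show ?thesis
      unfolding closed_segment_commute[of "?p u" "?p v"] closed_segment_commute[of "?p w" "?p z"]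
      using common[of v u w] by auto
  next
    case 5
    then show ?thesis using disj by auto
  next
    case 6
    then show ?thesis using disj by (metis Int_commute empty_subsetI)
  qed
qed

text \<open>Every vertex has to be an end of some arc. A vertex lying on a foreign edge would then
  violate the condition on pairs of edges, so pairs of arcs are all that is checked, each in one
  order.\<close>

definition lattice_drawing :: "nat \<Rightarrow> (nat \<times> nat) list \<Rightarrow> (int \<times> int) list \<Rightarrow> bool" where
  "lattice_drawing n A pts \<longleftrightarrow> length pts = n \<and> distinct pts \<and> sorted_wrt (separated pts) A \<and>
     set (map fst A @ map snd A) = set [0..<n]"

lemma lattice_drawing_straight:
  assumes "lattice_drawing n A pts"
  shows "straight_drawing {..<n} (underlying_edges \<lparr>pverts = {..<n}, parcs = set A\<rparr>) {} (lattice_point pts)"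
proof -
  let ?p = "lattice_point pts" and ?E = "underlying_edges \<lparr>pverts = {..<n}, parcs = set A\<rparr>"
  have len: "length pts = n" and dist: "distinct pts" and sep: "sorted_wrt (separated pts) A"
    and ends: "fst ` set A \<union> snd ` set A = {..<n}"
    using assms by (auto simp: lattice_drawing_def)
  have inj: "inj_on ?p {..<n}"
    using len dist by (auto simp: inj_on_def lattice_point_def prod_eq_iff nth_eq_iff_index_eq)
      (metis nth_eq_iff_index_eq prod_eqI)
  have edge: "\<exists>(u, v) \<in> set A. e = {u, v}" if "e \<in> ?E" for e
    using that by (auto simp: underlying_edges_def)
  have sub: "\<Union>?E \<subseteq> {..<n}" using ends by (force simp: underlying_edges_def)
  have cross: "convex hull (?p ` e) \<inter> convex hull (?p ` f) \<subseteq> ?p ` (e \<inter> f)"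
    if e: "e \<in> ?E" and f: "f \<in> ?E" and "e \<noteq> f" for e f
  proof -
    obtain u v where uv: "(u, v) \<in> set A" "e = {u, v}" using edge[OF e] by blast
    obtain w z where wz: "(w, z) \<in> set A" "f = {w, z}" using edge[OF f] by blast
    obtain i where i: "i < length A" "A ! i = (u, v)" using uv(1) by (auto simp: in_set_conv_nth)
    obtain j where j: "j < length A" "A ! j = (w, z)" using wz(1) by (auto simp: in_set_conv_nth)
    have "i \<noteq> j" using i j uv wz \<open>e \<noteq> f\<close> by auto
    then have "separated pts (u, v) (w, z) \<or> separated pts (w, z) (u, v)"
      using sep i j by (metis linorder_neqE_nat sorted_wrt_iff_nth_less)
    then show ?thesis
      using separated_segments[of pts u v w z] separated_segments[of pts w z u v]
      unfolding uv wz by (auto simp: segment_convex_hull[symmetric] Int_commute)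
  qed
  have "convex hull (?p ` e) \<inter> ?p ` {..<n} \<subseteq> ?p ` e" if e: "e \<in> ?E" for e
  proof
    fix q assume q: "q \<in> convex hull (?p ` e) \<inter> ?p ` {..<n}"
    then obtain w where w: "w < n" "q = ?p w" by auto
    have "w \<in> fst ` set A \<union> snd ` set A" using ends w(1) by simp
    then obtain u v where uv: "(u, v) \<in> set A" "w = u \<or> w = v" by auto
    then have f: "{u, v} \<in> ?E" "w \<in> {u, v}" by (auto simp: underlying_edges_def)
    show "q \<in> ?p ` e"
    proof (cases "e = {u, v}")
      case False
      have "q \<in> convex hull (?p ` {u, v})" using f(2) w(2) by (intro hull_inc) auto
      then show ?thesis using cross[OF e f(1) False] q by auto
    qed (use f w in auto)
  qed
  then show ?thesis using inj sub cross by (auto simp: straight_drawing_def)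
qed

lemma lattice_drawing_upward_planar:
  assumes "lattice_drawing n A pts" and up: "list_all (\<lambda>(u, v). snd (pts ! u) < snd (pts ! v)) A"
  shows "upward_planar_dag \<lparr>pverts = {..<n}, parcs = set A\<rparr>"
proof (rule upward_planar_dagI[OF _ _ lattice_drawing_straight[OF assms(1)]])
  show "set A \<subseteq> {..<n} \<times> {..<n}"
    using assms(1) by (force simp: lattice_drawing_def atLeast0LessThan)
  show "Im (lattice_point pts u) < Im (lattice_point pts v)" if "(u, v) \<in> set A" for u v
    using up that by (auto simp: list_all_iff lattice_point_def)
qed simp

lemma straight_drawing_cong:
  assumes "straight_drawing V E {} p" "\<And>v. v \<in> V \<Longrightarrow> p v = q v"
  shows "straight_drawing V E {} q"
proof -
  have image: "q ` s = p ` s" if "s \<subseteq> V" for s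
    by (rule image_cong) (use that assms(2) in auto)
  have E: "\<Union>E \<subseteq> V" using assms(1) by (simp add: straight_drawing_def)
  have e: "q ` e = p ` e" if "e \<in> E" for e using E that by (intro image) blast
  have ef: "q ` (e \<inter> f) = p ` (e \<inter> f)" if "e \<in> E" for e f using E that by (intro image) blast
  have "inj_on p V" using assms(1) by (simp add: straight_drawing_def)
  then have "inj_on q V" using assms(2) by (auto simp: inj_on_def)
  moreover have "convex hull (q ` e) \<inter> q ` V \<subseteq> q ` e" if "e \<in> E" for e
    unfolding e[OF that] image[OF order_refl] using assms(1) that by (simp add: straight_drawing_def)
  moreover have "convex hull (q ` e) \<inter> convex hull (q ` f) \<subseteq> q ` (e \<inter> f)"
    if "e \<in> E" "f \<in> E" "e \<noteq> f" for e f
    unfolding e[OF that(1)] e[OF that(2)] ef[OF that(1)] using assms(1) that by (simp add: straight_drawing_def)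
  ultimately show ?thesis using E by (simp add: straight_drawing_def)
qed

lemma lattice_drawing_outerplanar:
  assumes dr: "lattice_drawing n A (map (\<lambda>x. (x, x\<^sup>2)) xs)" and "list_all (\<lambda>(u, v). u \<noteq> v) A"
  shows "outerplanar {..<n} (underlying_edges \<lparr>pverts = {..<n}, parcs = set A\<rparr>)"
proof (rule outerplanarI[where h = "\<lambda>v. of_int (xs ! v)"])
  let ?p = "\<lambda>v. Complex (of_int (xs ! v)) ((of_int (xs ! v))\<^sup>2)"
  have "length xs = n" using dr by (simp add: lattice_drawing_def)
  \<comment> \<open>\<open>map\<close> commutes with \<open>!\<close> only within the length of the
    list; the congruence lemma absorbs the other indices.\<close>
  then have "lattice_point (map (\<lambda>x. (x, x\<^sup>2)) xs) v = ?p v" if "v \<in> {..<n}" for v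
    using that by (simp add: lattice_point_def)
  then show "straight_drawing {..<n} (underlying_edges \<lparr>pverts = {..<n}, parcs = set A\<rparr>) {} ?p"
    by (rule straight_drawing_cong[OF lattice_drawing_straight[OF dr]])
  show "\<exists>u v. e = {u, v} \<and> u \<noteq> v" if "e \<in> underlying_edges \<lparr>pverts = {..<n}, parcs = set A\<rparr>" for e
    using assms(2) that by (fastforce simp: underlying_edges_def list_all_iff)
qed

section \<open>Upward planar 3-trees\<close>

text \<open>The new edges, up to their old ends, and the new face interiors lie in the open
  triangle, which meets no old vertex, no old edge and no other face interior. This settles new
  against old; new against new is settled by the star lemmas around \<open>z\<close>.\<close>

lemma straight_drawing_insert:
  assumes dr: "straight_drawing V E F p" and t: "{a, b, c} \<in> F" and x: "x \<notin> V"
    and nc: "noncollinear (p a) (p b) (p c)" and z: "z \<in> open_triangle (p a) (p b) (p c)"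
  shows "straight_drawing (insert x V) (E \<union> {{x, a}, {x, b}, {x, c}})
      (F - {{a, b, c}} \<union> {{x, a, b}, {x, b, c}, {x, a, c}}) (p(x := z))"
proof -
  let ?T = "open_triangle (p a) (p b) (p c)"
  define q where "q = p(x := z)"
  have qx [simp]: "q x = z" and qV [simp]: "\<And>v. v \<in> V \<Longrightarrow> q v = p v"
    using x by (auto simp: q_def)
  let ?H = "\<lambda>e. convex hull (q ` e)"
  let ?I = "\<lambda>t. interior (convex hull (q ` t))"
  define N where "N = {{x, a}, {x, b}, {x, c}}"
  define NF where "NF = {{x, a, b}, {x, b, c}, {x, a, c}}"
  have inj: "inj_on p V" and EV: "\<Union>E \<subseteq> V"
    and edge_vertex: "\<And>e. e \<in> E \<Longrightarrow> convex hull (p ` e) \<inter> p ` V \<subseteq> p ` e"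
    and edge_edge: "\<And>e f. e \<in> E \<Longrightarrow> f \<in> E \<Longrightarrow> e \<noteq> f \<Longrightarrow> convex hull (p ` e) \<inter> convex hull (p ` f) \<subseteq> p ` (e \<inter> f)"
    and face: "\<And>t. t \<in> F \<Longrightarrow> \<exists>a b c. t = {a, b, c} \<and> t \<subseteq> V \<and> noncollinear (p a) (p b) (p c)"
    and face_vertex: "\<And>t. t \<in> F \<Longrightarrow> interior (convex hull (p ` t)) \<inter> p ` V = {}"
    and face_edge: "\<And>t e. t \<in> F \<Longrightarrow> e \<in> E \<Longrightarrow> interior (convex hull (p ` t)) \<inter> convex hull (p ` e) = {}"
    and face_face: "\<And>s t. s \<in> F \<Longrightarrow> t \<in> F \<Longrightarrow> s \<noteq> t \<Longrightarrow>
      interior (convex hull (p ` s)) \<inter> interior (convex hull (p ` t)) = {}"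
    using dr by (auto simp: straight_drawing_def)
  have abc: "a \<in> V" "b \<in> V" "c \<in> V" using face[OF t] by auto
  have ne: "a \<noteq> b" "b \<noteq> c" "a \<noteq> c" using nc by (auto simp: noncollinear_def cross_prod_def)
  have T: "interior (convex hull (p ` {a, b, c})) = ?T"
    using interior_triangle[OF nc] by simp
  have old: "q ` s = p ` s" if "s \<subseteq> V" for s
    by (rule image_cong) (use that in auto)
  have E_old: "q ` e = p ` e" if "e \<in> E" for e using old EV that by blast
  have F_old: "q ` t = p ` t" if "t \<in> F" for t using old face[OF that] by blast
  have z_new: "z \<notin> p ` V" "\<And>e. e \<in> E \<Longrightarrow> z \<notin> convex hull (p ` e)"
    using face_vertex[OF t] face_edge[OF t] z T by auto
  \<comment> \<open>The star lemmas single out particular corners; the six labellings transfer them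
    to all cases.\<close>
  define perms where "perms = {(a, b, c), (a, c, b), (b, a, c), (b, c, a), (c, a, b), (c, b, a)}"
  have perms_V: "u \<in> V" "v \<in> V" "w \<in> V" if "(u, v, w) \<in> perms" for u v w
    using that abc by (auto simp: perms_def)
  have perm: "noncollinear (p u) (p v) (p w)" "open_triangle (p u) (p v) (p w) = ?T"
    if "(u, v, w) \<in> perms" for u v w
    using that nc unfolding perms_def
    by (auto simp: noncollinear_commute) (metis open_triangle_commute)+
  have H: "?H {x, u} = closed_segment z (p u)" if "u \<in> V" for u
    using that by (simp add: segment_convex_hull)
  have zp: "z \<in> open_triangle (p u) (p v) (p w)" if "(u, v, w) \<in> perms" for u v w
    using perm(2)[OF that] z by simp
  have seg: "?H {x, u} \<subseteq> insert (p u) ?T" "?H {x, u} \<inter> ?H {x, v} \<subseteq> {z}"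
    if uvw: "(u, v, w) \<in> perms" for u v w
    unfolding H[OF perms_V(1)[OF uvw]] H[OF perms_V(2)[OF uvw]]
    using star_segment_subset[OF perm(1) zp, OF uvw uvw]
      star_segments_disjoint[OF perm(1) zp, OF uvw uvw] perm(2)[OF uvw] by simp_all
  have tri_nc: "noncollinear z (p v) (p w)" if uvw: "(u, v, w) \<in> perms" for u v w
    by (rule noncollinear_star[OF perm(1) zp, OF uvw uvw])
  have tri_I: "?I {x, v, w} = open_triangle z (p v) (p w)" if uvw: "(u, v, w) \<in> perms" for u v w
    using interior_triangle[OF tri_nc[OF uvw]] perms_V[OF uvw] by simp
  have tri: "?I {x, v, w} \<subseteq> ?T" "?I {x, v, w} \<inter> ?H {x, u} = {}" "?I {x, v, w} \<inter> ?H {x, v} = {}"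
    if uvw: "(u, v, w) \<in> perms" for u v w
    unfolding H[OF perms_V(1)[OF uvw]] H[OF perms_V(2)[OF uvw]] tri_I[OF uvw]
    using star_triangle_subset[OF perm(1) zp, OF uvw uvw]
      star_triangle_segment_disjoint[OF perm(1) zp, OF uvw uvw] perm(2)[OF uvw] by simp_all
  have tri_tri: "?I {x, v, w} \<inter> ?I {x, u, w} = {}"
    if uvw: "(u, v, w) \<in> perms" and vuw: "(v, u, w) \<in> perms" for u v w
    unfolding tri_I[OF uvw] tri_I[OF vuw] by (rule star_triangles_disjoint[OF perm(1) zp, OF uvw uvw])
  have N: "\<exists>v\<in>V. e = {x, v} \<and> ?H e \<subseteq> insert (p v) ?T" if "e \<in> N" for e
    using that seg(1)[of a b c] seg(1)[of b a c] seg(1)[of c a b] abc unfolding N_def perms_def by blast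
  have NN: "?H e \<inter> ?H f \<subseteq> {z}" if "e \<in> N" "f \<in> N" "e \<noteq> f" for e f
    using that seg(2)[of a b c] seg(2)[of a c b] seg(2)[of b c a]
    unfolding N_def perms_def by blast
  have NF: "\<exists>u v w. t = {u, v, w} \<and> t \<subseteq> insert x V \<and> noncollinear (q u) (q v) (q w) \<and> ?I t \<subseteq> ?T \<and> x \<in> t" if t: "t \<in> NF" for t
  proof -
    consider "t = {x, a, b}" | "t = {x, b, c}" | "t = {x, a, c}" using t unfolding NF_def by blast
    then show ?thesis
    proof cases
      case 1
      have "(c, a, b) \<in> perms" by (simp add: perms_def)
      from tri_nc[OF this] tri(1)[OF this] 1 abc x show ?thesis
        by (intro exI[of _ x] exI[of _ a] exI[of _ b]) auto
    next
      case 2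
      have "(a, b, c) \<in> perms" by (simp add: perms_def)
      from tri_nc[OF this] tri(1)[OF this] 2 abc x show ?thesis
        by (intro exI[of _ x] exI[of _ b] exI[of _ c]) auto
    next
      case 3
      have "(b, a, c) \<in> perms" by (simp add: perms_def)
      from tri_nc[OF this] tri(1)[OF this] 3 abc x show ?thesis
        by (intro exI[of _ x] exI[of _ a] exI[of _ c]) auto
    qed
  qed
  have swap: "{x, v, w} = {x, w, v}" for v w by auto
  have tri_N: "\<forall>e \<in> N. ?I {x, v, w} \<inter> ?H e = {}" if uvw: "(u, v, w) \<in> perms" for u v w
  proof -
    have uwv: "(u, w, v) \<in> perms" and N: "N = {{x, u}, {x, v}, {x, w}}"
      using uvw unfolding perms_def N_def by auto
    show ?thesis
      unfolding N using tri(2,3)[OF uvw] tri(3)[OF uwv] unfolding swap[of w v] by blast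
  qed
  have NF_N: "?I t \<inter> ?H e = {}" if "t \<in> NF" "e \<in> N" for t e
  proof -
    have "(c, a, b) \<in> perms" "(a, b, c) \<in> perms" "(b, a, c) \<in> perms"
      by (simp_all add: perms_def)
    note tri_N[OF this(1)] tri_N[OF this(2)] tri_N[OF this(3)]
    then have "\<forall>e \<in> N. ?I t \<inter> ?H e = {}"
      using that(1) unfolding NF_def by (elim insertE emptyE) simp_all
    then show ?thesis using that(2) by blast
  qed
  have tri_tri1: "?I {x, b, c} \<inter> ?I {x, a, c} = {}"
    by (rule tri_tri) (simp_all add: perms_def)
  have tri_tri2: "?I {x, c, b} \<inter> ?I {x, a, b} = {}"
    by (rule tri_tri) (simp_all add: perms_def)
  have tri_tri3: "?I {x, c, a} \<inter> ?I {x, b, a} = {}"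
    by (rule tri_tri) (simp_all add: perms_def)
  have NF_NF: "?I s \<inter> ?I t = {}" if "s \<in> NF" "t \<in> NF" "s \<noteq> t" for s t
    using that tri_tri1 tri_tri2[unfolded swap[of c b]] tri_tri3[unfolded swap[of c a] swap[of b a]]
    unfolding NF_def by (metis Int_commute insertE emptyE)
  \<comment> \<open>\<open>z\<close> lies on the new edge to \<open>a\<close>, which the new faces
    avoid.\<close>
  have NFz: "z \<notin> ?I t" if "t \<in> NF" for t
    using NF_N[OF that, of "{x, a}"] H[OF abc(1)] by (auto simp: N_def)
  have T_old: "?T \<inter> p ` V = {}" "\<And>e. e \<in> E \<Longrightarrow> ?T \<inter> convex hull (p ` e) = {}"
    "\<And>s. s \<in> F \<Longrightarrow> s \<noteq> {a, b, c} \<Longrightarrow> ?T \<inter> interior (convex hull (p ` s)) = {}"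
    using face_vertex[OF t] face_edge[OF t] face_face[OF t] T by auto
  have pV: "q ` insert x V = insert z (p ` V)" using old[of V] by auto
  \<comment> \<open>Outside the open triangle a new edge has only its old end \<open>v\<close>, and
    an old edge passes through a vertex only at its own ends.\<close>
  have E_N: "?H e \<inter> ?H f \<subseteq> q ` (e \<inter> f)" if e: "e \<in> E" and f: "f \<in> N" for e f
  proof
    fix y assume y: "y \<in> ?H e \<inter> ?H f"
    obtain v where v: "v \<in> V" "f = {x, v}" "?H f \<subseteq> insert (p v) ?T" using N[OF f] by blast
    have "y = p v" using y v(3) T_old(2)[OF e] E_old[OF e] by auto
    then have "p v \<in> p ` e" using y edge_vertex[OF e] E_old[OF e] v(1) by auto
    then have "v \<in> e" using inj v(1) EV e by (meson Union_upper inj_on_image_mem_iff subset_trans)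
    then show "y \<in> q ` (e \<inter> f)" using \<open>y = p v\<close> v(2) qV[OF v(1)] by (metis IntI image_eqI insertCI)
  qed
  have NFT: "?I t \<subseteq> ?T" if "t \<in> NF" for t
    using NF[OF that] by blast
  have I_old: "?T \<inter> ?I t = {}" "?I t \<inter> p ` V = {}" if "t \<in> F - {{a, b, c}}" for t
    using T_old(3)[of t] face_vertex[of t] F_old[of t] that by simp_all
  have I_E: "?I t \<inter> ?H e = {}" if "t \<in> F - {{a, b, c}}" "e \<in> E" for t e
    using face_edge[of t e] F_old[of t] E_old[of e] that by simp
  have T_E: "?T \<inter> ?H e = {}" if "e \<in> E" for e
    using T_old(2)[OF that] E_old[OF that] by simp
  have I_I: "?I s \<inter> ?I t = {}" if "s \<in> F - {{a, b, c}}" "t \<in> F - {{a, b, c}}" "s \<noteq> t" for s t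
    using face_face[of s t] F_old[of s] F_old[of t] that by simp
  show ?thesis
    unfolding straight_drawing_def N_def[symmetric] NF_def[symmetric] q_def[symmetric]
  proof (intro conjI ballI impI)
    show "inj_on q (insert x V)"
      using inj x z_new(1) by (auto simp: inj_on_def)
    show "\<Union>(E \<union> N) \<subseteq> insert x V"
      using EV N by blast
  next
    fix e assume "e \<in> E \<union> N"
    then show "?H e \<inter> q ` insert x V \<subseteq> q ` e"
    proof
      assume e: "e \<in> E"
      then show ?thesis using edge_vertex[OF e] z_new(2)[OF e] E_old[OF e] unfolding pV by auto
    next
      assume "e \<in> N"
      then obtain v where "v \<in> V" "e = {x, v}" "?H e \<subseteq> insert (p v) ?T" using N by blast
      then show ?thesis using T_old(1) x unfolding pV by auto
    qed
  next
    fix e f assume "e \<in> E \<union> N" "f \<in> E \<union> N" "e \<noteq> f"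
    moreover have "z \<in> q ` (e \<inter> f)" if "e \<in> N" "f \<in> N"
      using that N by (metis IntI qx image_eqI insertI1)
    moreover have "?H e \<inter> ?H f \<subseteq> q ` (e \<inter> f)" if "e \<in> E" "f \<in> E"
    proof -
      have "e \<inter> f \<subseteq> V" using that EV by blast
      then show ?thesis
        using edge_edge[OF that \<open>e \<noteq> f\<close>] unfolding E_old[OF that(1)] E_old[OF that(2)] by (simp only: old)
    qed
    moreover have "?H e \<inter> ?H f \<subseteq> q ` (e \<inter> f)" if "e \<in> N" "f \<in> E"
      using E_N[OF that(2,1)] by (simp add: Int_commute)
    ultimately show "?H e \<inter> ?H f \<subseteq> q ` (e \<inter> f)"
      using E_N[of e f] NN[of e f] by blast
  next
    fix t assume "t \<in> F - {{a, b, c}} \<union> NF"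
    then show "\<exists>a b c. t = {a, b, c} \<and> t \<subseteq> insert x V \<and> noncollinear (q a) (q b) (q c)"
    proof
      assume "t \<in> F - {{a, b, c}}"
      then obtain u v w where "t = {u, v, w}" "t \<subseteq> V" "noncollinear (p u) (p v) (p w)" using face by blast
      then show ?thesis using x by (intro exI[of _ u] exI[of _ v] exI[of _ w]) auto
    qed (use NF in blast)
  next
    fix t assume t': "t \<in> F - {{a, b, c}} \<union> NF"
    show "?I t \<inter> q ` insert x V = {}"
      using t' I_old[of t] NFT[of t] NFz[of t] z T_old(1) unfolding pV by blast
  next
    fix t e assume t': "t \<in> F - {{a, b, c}} \<union> NF" and e: "e \<in> E \<union> N"
    have "?I t \<inter> ?H e = {}" if t': "t \<in> F - {{a, b, c}}" and e: "e \<in> N"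
    proof -
      obtain v where "v \<in> V" "?H e \<subseteq> insert (p v) ?T" using N[OF e] by blast
      then show ?thesis using I_old[OF t'] by blast
    qed
    moreover have "?I t \<inter> ?H e = {}" if "t \<in> NF" "e \<in> E"
      using NFT[OF that(1)] T_E[OF that(2)] by blast
    ultimately show "?I t \<inter> ?H e = {}"
      using t' e I_E[of t e] NF_N[of t e] by blast
  next
    fix s t assume "s \<in> F - {{a, b, c}} \<union> NF" "t \<in> F - {{a, b, c}} \<union> NF" "s \<noteq> t"
    moreover have "?I s \<inter> ?I t = {}" if "s \<in> F - {{a, b, c}}" "t \<in> NF" for s t
      using I_old(1)[OF that(1)] NFT[OF that(2)] by blast
    moreover from this have "?I t \<inter> ?I s = {}" if "s \<in> F - {{a, b, c}}" "t \<in> NF" for s t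
      using that by (simp only: Int_commute)
    ultimately show "?I s \<inter> ?I t = {}"
      using I_I[of s t] NF_NF[of s t] by (elim UnE) blast+
  qed
qed

lemma open_triangle_heights:
  assumes "Im a < Im b" "Im b < Im c"
  obtains y z where "y \<in> open_triangle a b c" "Im a < Im y" "Im y < Im b"
    "z \<in> open_triangle a b c" "Im b < Im z" "Im z < Im c"
proof
  \<comment> \<open>The weights \<open>1 - 2 * d\<close>, \<open>d\<close>, \<open>d\<close> raise
    the height above \<open>Im a\<close> by \<open>d * (Im b - Im a) + d * (Im c - Im a)\<close>.
    With this \<open>d\<close> the second term is one third of \<open>Im b - Im a\<close>, and
    \<open>d < 1 / 3\<close> keeps the first below another third, so \<open>Im b\<close> is not
    reached. \<open>e\<close> is the mirror image at \<open>c\<close>.\<close>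
  define d where "d = (Im b - Im a) / (3 * (Im c - Im a))"
  define e where "e = (Im c - Im b) / (3 * (Im c - Im a))"
  have ac: "Im c - Im a > 0" using assms by simp
  have d: "0 < d" "d < 1 / 3" "d * (Im c - Im a) = (Im b - Im a) / 3"
    and e: "0 < e" "e < 1 / 3" "e * (Im c - Im a) = (Im c - Im b) / 3"
    using assms ac by (auto simp: d_def e_def field_simps)
  have low: "0 < d * (Im b - Im a)" "d * (Im b - Im a) < 1 / 3 * (Im b - Im a)"
    and high: "0 < e * (Im c - Im b)" "e * (Im c - Im b) < 1 / 3 * (Im c - Im b)"
    using assms d e by (simp_all only: mult_pos_pos diff_gt_0_iff_gt mult_strict_right_mono)
  have y: "Im ((1 - 2 * d) *\<^sub>R a + d *\<^sub>R b + d *\<^sub>R c) = Im a + d * (Im b - Im a) + d * (Im c - Im a)"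
    and z: "Im (e *\<^sub>R a + e *\<^sub>R b + (1 - 2 * e) *\<^sub>R c) = Im c - e * (Im c - Im b) - e * (Im c - Im a)"
    by (simp_all add: algebra_simps)
  show "Im a < Im ((1 - 2 * d) *\<^sub>R a + d *\<^sub>R b + d *\<^sub>R c)"
    "Im ((1 - 2 * d) *\<^sub>R a + d *\<^sub>R b + d *\<^sub>R c) < Im b"
    unfolding y d(3) using assms low by argo+
  show "Im b < Im (e *\<^sub>R a + e *\<^sub>R b + (1 - 2 * e) *\<^sub>R c)"
    "Im (e *\<^sub>R a + e *\<^sub>R b + (1 - 2 * e) *\<^sub>R c) < Im c"
    unfolding z e(3) using assms high by argo+
  show "(1 - 2 * d) *\<^sub>R a + d *\<^sub>R b + d *\<^sub>R c \<in> open_triangle a b c"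
    "e *\<^sub>R a + e *\<^sub>R b + (1 - 2 * e) *\<^sub>R c \<in> open_triangle a b c"
    using d e by (auto intro!: open_triangleI)
qed

section \<open>Planar 3-trees with oriented faces\<close>

text \<open>A face is listed as \<open>(a, b, c)\<close> if its arcs are \<open>a \<rightarrow> b\<close>, \<open>b \<rightarrow> c\<close> and \<open>a \<rightarrow> c\<close>.
  An inserted vertex then lies above \<open>a\<close> and below \<open>c\<close>, so that only its position relative to \<open>b\<close>
  can be chosen.\<close>

inductive upward_3_tree_faces :: "'a set \<Rightarrow> 'a rel \<Rightarrow> ('a \<times> 'a \<times> 'a) set \<Rightarrow> bool" where
  triangle: "a \<noteq> b \<Longrightarrow> b \<noteq> c \<Longrightarrow> a \<noteq> c \<Longrightarrow>
    upward_3_tree_faces {a, b, c} {(a, b), (b, c), (a, c)} {(a, b, c)}"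
| low: "upward_3_tree_faces V A F \<Longrightarrow> (a, b, c) \<in> F \<Longrightarrow> x \<notin> V \<Longrightarrow>
    upward_3_tree_faces (insert x V) (A \<union> {(a, x), (x, b), (x, c)})
      (F - {(a, b, c)} \<union> {(a, x, b), (x, b, c), (a, x, c)})"
| high: "upward_3_tree_faces V A F \<Longrightarrow> (a, b, c) \<in> F \<Longrightarrow> x \<notin> V \<Longrightarrow>
    upward_3_tree_faces (insert x V) (A \<union> {(a, x), (b, x), (x, c)})
      (F - {(a, b, c)} \<union> {(a, b, x), (b, x, c), (a, x, c)})"

lemma upward_3_tree_faces_arcs:
  assumes "upward_3_tree_faces V A F"
  shows "finite V \<and> A \<subseteq> V \<times> V \<and> (\<forall>(a, b, c) \<in> F. (a, b) \<in> A \<and> (b, c) \<in> A \<and> (a, c) \<in> A)"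
  using assms by induction (auto; fast)+

definition corners :: "'a \<times> 'a \<times> 'a \<Rightarrow> 'a set" where
  "corners = (\<lambda>(a, b, c). {a, b, c})"

lemma corners_eq_iff:
  fixes h :: "'a \<Rightarrow> real"
  assumes "h a < h b" "h b < h c" "h a' < h b'" "h b' < h c'"
  shows "{a, b, c} = {a', b', c'} \<longleftrightarrow> a = a' \<and> b = b' \<and> c = c'"
proof
  assume eq: "{a, b, c} = {a', b', c'}"
  then have "a \<in> {a', b', c'}" "b \<in> {a', b', c'}" "c \<in> {a', b', c'}"
    "a' \<in> {a, b, c}" "c' \<in> {a, b, c}" by blast+
  then show "a = a' \<and> b = b' \<and> c = c'" using assms by auto
qed auto

lemma noncollinear_corners:
  assumes "{a, b, c} = {a', b', c'}" "noncollinear (p a') (p b') (p c')" "a \<noteq> b" "b \<noteq> c" "a \<noteq> c"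
  shows "noncollinear (p a) (p b) (p c)"
proof -
  have "a \<in> {a', b', c'}" "b \<in> {a', b', c'}" "c \<in> {a', b', c'}" using assms(1) by blast+
  then show ?thesis using assms(2-) by (elim insertE emptyE) (simp_all add: noncollinear_commute)
qed

definition upward_drawing :: "'a set \<Rightarrow> 'a rel \<Rightarrow> ('a \<times> 'a \<times> 'a) set \<Rightarrow> ('a \<Rightarrow> complex) \<Rightarrow> bool" where
  "upward_drawing V A F p \<longleftrightarrow>
     straight_drawing V (underlying_edges \<lparr>pverts = V, parcs = A\<rparr>) (corners ` F) p \<and>
     (\<forall>(u, v) \<in> A. Im (p u) < Im (p v))"

context
  fixes V :: "'a set" and A F a b c x
  assumes tree: "upward_3_tree_faces V A F" and face: "(a, b, c) \<in> F" and x: "x \<notin> V"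
begin

lemma corner_arcs: "(a, b) \<in> A" "(b, c) \<in> A" "(a, c) \<in> A"
  using upward_3_tree_faces_arcs[OF tree] face by auto

text \<open>An image commutes with removal only under injectivity. The heights sort the corners of a
  face, so its corner set determines the triple.\<close>

lemma corners_removed:
  assumes "upward_drawing V A F p"
  shows "corners ` (F - {(a, b, c)}) = corners ` F - {{a, b, c}}"
proof -
  have "t = (a, b, c)" if "t \<in> F" "corners t = {a, b, c}" for t
  proof -
    obtain a' b' c' where t: "t = (a', b', c')" by (cases t)
    have "Im (p a') < Im (p b')" "Im (p b') < Im (p c')" "Im (p a) < Im (p b)" "Im (p b) < Im (p c)"
      using that(1) assms corner_arcs upward_3_tree_faces_arcs[OF tree] unfolding t upward_drawing_def by auto
    then show ?thesis
      using corners_eq_iff[of "\<lambda>v. Im (p v)" a' b' c' a b c] that(2) by (simp add: t corners_def)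
  qed
  then show ?thesis by (auto simp: corners_def)
qed

lemma upward_drawing_insert:
  assumes "upward_drawing V A F p"
  obtains q r where
    "upward_drawing (insert x V) (A \<union> {(a, x), (x, b), (x, c)})
      (F - {(a, b, c)} \<union> {(a, x, b), (x, b, c), (a, x, c)}) q"
    "upward_drawing (insert x V) (A \<union> {(a, x), (b, x), (x, c)})
      (F - {(a, b, c)} \<union> {(a, b, x), (b, x, c), (a, x, c)}) r"
proof -
  let ?E = "underlying_edges \<lparr>pverts = V, parcs = A\<rparr>"
  have dr: "straight_drawing V ?E (corners ` F) p" and up: "\<And>u v. (u, v) \<in> A \<Longrightarrow> Im (p u) < Im (p v)"
    using assms by (auto simp: upward_drawing_def)
  have abc: "{a, b, c} \<in> corners ` F" using face by (force simp: corners_def)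
  have heights: "Im (p a) < Im (p b)" "Im (p b) < Im (p c)" using up corner_arcs by auto
  then have ne: "a \<noteq> b" "b \<noteq> c" "a \<noteq> c" by auto
  have nc: "noncollinear (p a) (p b) (p c)"
    using dr abc ne noncollinear_corners unfolding straight_drawing_def by metis
  obtain y z where y: "y \<in> open_triangle (p a) (p b) (p c)" "Im (p a) < Im y" "Im y < Im (p b)"
    and z: "z \<in> open_triangle (p a) (p b) (p c)" "Im (p b) < Im z" "Im z < Im (p c)"
    using open_triangle_heights[OF heights] .
  have A: "A \<subseteq> V \<times> V" using upward_3_tree_faces_arcs[OF tree] by blast
  have old: "Im ((p(x := w)) u) < Im ((p(x := w)) v)" if "(u, v) \<in> A" for u v w
    using up[OF that] that A x by auto
  have arcs: "\<forall>(u, v) \<in> A \<union> B. Im ((p(x := w)) u) < Im ((p(x := w)) v)"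
    if "\<And>u v. (u, v) \<in> B \<Longrightarrow> Im ((p(x := w)) u) < Im ((p(x := w)) v)" for w B
    using old that by blast
  have V: "a \<in> V" "b \<in> V" "c \<in> V" using corner_arcs A by auto
  show thesis
  proof
    have "underlying_edges \<lparr>pverts = insert x V, parcs = A \<union> {(a, x), (x, b), (x, c)}\<rparr>
        = ?E \<union> {{x, a}, {x, b}, {x, c}}"
      "corners ` (F - {(a, b, c)} \<union> {(a, x, b), (x, b, c), (a, x, c)})
        = corners ` F - {{a, b, c}} \<union> {{x, a, b}, {x, b, c}, {x, a, c}}"
      unfolding image_Un corners_removed[OF assms]
      by (simp_all add: underlying_edges_def corners_def image_Un insert_commute)
    then show "upward_drawing (insert x V) (A \<union> {(a, x), (x, b), (x, c)})
      (F - {(a, b, c)} \<union> {(a, x, b), (x, b, c), (a, x, c)}) (p(x := y))"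
      unfolding upward_drawing_def
      using straight_drawing_insert[OF dr abc x nc y(1)] x V y heights
      by (intro conjI arcs) (simp_all, fastforce)
    have "underlying_edges \<lparr>pverts = insert x V, parcs = A \<union> {(a, x), (b, x), (x, c)}\<rparr>
        = ?E \<union> {{x, a}, {x, b}, {x, c}}"
      "corners ` (F - {(a, b, c)} \<union> {(a, b, x), (b, x, c), (a, x, c)})
        = corners ` F - {{a, b, c}} \<union> {{x, a, b}, {x, b, c}, {x, a, c}}"
      unfolding image_Un corners_removed[OF assms]
      by (simp_all add: underlying_edges_def corners_def image_Un insert_commute)
    then show "upward_drawing (insert x V) (A \<union> {(a, x), (b, x), (x, c)})
      (F - {(a, b, c)} \<union> {(a, b, x), (b, x, c), (a, x, c)}) (p(x := z))"
      unfolding upward_drawing_def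
      using straight_drawing_insert[OF dr abc x nc z(1)] x V z heights
      by (intro conjI arcs) (simp_all, fastforce)
  qed
qed

end

lemma straight_drawing_triangle:
  assumes nc: "noncollinear (p a) (p b) (p c)"
  shows "straight_drawing {a, b, c} {{a, b}, {b, c}, {a, c}} {{a, b, c}} p"
proof -
  let ?T = "open_triangle (p a) (p b) (p c)"
  have nc': "noncollinear (p b) (p a) (p c)" "noncollinear (p c) (p a) (p b)"
    using nc by (simp_all add: noncollinear_commute)
  have ne: "p a \<noteq> p b" "p b \<noteq> p c" "p a \<noteq> p c"
    using nc by (auto simp: noncollinear_def cross_prod_def)
  then have ne': "a \<noteq> b" "b \<noteq> c" "a \<noteq> c" by auto
  have ab: "convex hull {p a, p b} = closed_segment (p a) (p b)"
    and bc: "convex hull {p b, p c} = closed_segment (p b) (p c)"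
    and ac: "convex hull {p a, p c} = closed_segment (p a) (p c)"
    by (simp_all add: segment_convex_hull)
  have 1: "closed_segment (p a) (p b) \<inter> closed_segment (p a) (p c) \<subseteq> {p a}"
    "closed_segment (p a) (p b) \<inter> closed_segment (p b) (p c) \<subseteq> {p b}"
    "closed_segment (p a) (p c) \<inter> closed_segment (p b) (p c) \<subseteq> {p c}"
    using triangle_segments(1)[OF nc] triangle_segments(1)[OF nc'(1)] triangle_segments(1)[OF nc'(2)]
    by (simp_all add: closed_segment_commute)
  have T: "open_triangle (p c) (p a) (p b) = ?T" "open_triangle (p b) (p c) (p a) = ?T" "open_triangle (p a) (p c) (p b) = ?T"
    by (metis open_triangle_commute)+
  have 2: "?T \<inter> closed_segment (p a) (p b) = {}" "?T \<inter> closed_segment (p a) (p c) = {}"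
    "?T \<inter> closed_segment (p b) (p c) = {}"
    using triangle_segments(2)[OF nc] triangle_segments(2)[of "p a" "p c" "p b"] triangle_segments(2)[of "p b" "p c" "p a"] nc
    by (simp_all add: noncollinear_commute T)
  have 3: "interior (convex hull {p a, p b, p c}) = ?T" by (rule interior_triangle[OF nc])
  have 4: "p c \<notin> closed_segment (p a) (p b)" "p b \<notin> closed_segment (p a) (p c)" "p a \<notin> closed_segment (p b) (p c)"
    using 1 ne by (auto dest: subsetD)
  have 5: "p a \<notin> ?T" "p b \<notin> ?T" "p c \<notin> ?T" using 2 by auto
  have [simp]: "{a, b} \<inter> {b, c} = {b}" "{b, c} \<inter> {a, b} = {b}" "{a, b} \<inter> {a, c} = {a}" "{a, c} \<inter> {a, b} = {a}"
    "{a, c} \<inter> {b, c} = {c}" "{b, c} \<inter> {a, c} = {c}" using ne' by auto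
  show ?thesis
    unfolding straight_drawing_def
  proof (intro conjI)
    show "inj_on p {a, b, c}" using ne by auto
    show "\<forall>e\<in>{{a, b}, {b, c}, {a, c}}. convex hull p ` e \<inter> p ` {a, b, c} \<subseteq> p ` e"
      using 4 by (simp add: ab bc ac)
    show "\<forall>e\<in>{{a, b}, {b, c}, {a, c}}. \<forall>f\<in>{{a, b}, {b, c}, {a, c}}. e \<noteq> f \<longrightarrow>
       convex hull p ` e \<inter> convex hull p ` f \<subseteq> p ` (e \<inter> f)"
      using 1 by (simp add: ab bc ac Int_commute) blast
    show "\<forall>t\<in>{{a, b, c}}. \<exists>u v w. t = {u, v, w} \<and> t \<subseteq> {a, b, c} \<and> noncollinear (p u) (p v) (p w)"
      using nc by blast
    show "\<forall>t\<in>{{a, b, c}}. interior (convex hull p ` t) \<inter> p ` {a, b, c} = {}"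
      using 5 by (simp add: 3)
    show "\<forall>t\<in>{{a, b, c}}. \<forall>e\<in>{{a, b}, {b, c}, {a, c}}. interior (convex hull p ` t) \<inter> convex hull p ` e = {}"
      using 2 by (simp add: 3 ab bc ac)
  qed auto
qed

lemma upward_3_tree_faces_drawing:
  assumes "upward_3_tree_faces V A F"
  shows "\<exists>p. upward_drawing V A F p"
  using assms
proof induction
  case (triangle a b c)
  \<comment> \<open>Heights 0, 1, 2, with the middle corner off the line through the other
    two.\<close>
  define p where "p v = (if v = a then 0 else if v = b then Complex 1 1 else Complex 0 2)" for v
  have "noncollinear (p a) (p b) (p c)"
    using triangle by (simp add: p_def noncollinear_def cross_prod_def)
  then have "upward_drawing {a, b, c} {(a, b), (b, c), (a, c)} {(a, b, c)} p"
    using straight_drawing_triangle[of p a b c] triangle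
    by (simp add: upward_drawing_def underlying_edges_def corners_def) (simp add: p_def)
  then show ?case by blast
next
  case (low V A F a b c x)
  then show ?case using upward_drawing_insert by metis
next
  case (high V A F a b c x)
  then show ?case using upward_drawing_insert by metis
qed

text \<open>The drawing serves a combinatorial purpose here: its heights show that the corners of a
  face differ and that removing a triple removes exactly one corner set.\<close>

lemma upward_3_tree_faces_planar:
  assumes "upward_3_tree_faces V A F"
  shows "planar_3_tree_faces V (underlying_edges \<lparr>pverts = V, parcs = A\<rparr>) (corners ` F)"
  using assms
proof induction
  case (triangle a b c)
  then show ?case
    using planar_3_tree_faces.triangle[of a b c] by (simp add: underlying_edges_def corners_def)
next
  case (low V A F a b c x)
  then obtain p where p: "upward_drawing V A F p" using upward_3_tree_faces_drawing by blast
  have "a \<noteq> b" "b \<noteq> c" "a \<noteq> c"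
    using corner_arcs[OF low(1-3)] p by (auto simp: upward_drawing_def)
  moreover have "{a, b, c} \<in> corners ` F" using low(2) by (force simp: corners_def)
  ultimately have "planar_3_tree_faces (insert x V) (underlying_edges \<lparr>pverts = V, parcs = A\<rparr> \<union> {{x, a}, {x, b}, {x, c}})
      (corners ` F - {{a, b, c}} \<union> {{x, a, b}, {x, b, c}, {x, a, c}})"
    using low planar_3_tree_faces.insertion by metis
  then show ?case
    unfolding image_Un corners_removed[OF low(1-3) p]
    by (simp add: underlying_edges_def corners_def insert_commute)
next
  case (high V A F a b c x)
  then obtain p where p: "upward_drawing V A F p" using upward_3_tree_faces_drawing by blast
  have "a \<noteq> b" "b \<noteq> c" "a \<noteq> c"
    using corner_arcs[OF high(1-3)] p by (auto simp: upward_drawing_def)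
  moreover have "{a, b, c} \<in> corners ` F" using high(2) by (force simp: corners_def)
  ultimately have "planar_3_tree_faces (insert x V) (underlying_edges \<lparr>pverts = V, parcs = A\<rparr> \<union> {{x, a}, {x, b}, {x, c}})
      (corners ` F - {{a, b, c}} \<union> {{x, a, b}, {x, b, c}, {x, a, c}})"
    using high planar_3_tree_faces.insertion by metis
  then show ?case
    unfolding image_Un corners_removed[OF high(1-3) p]
    by (simp add: underlying_edges_def corners_def insert_commute)
qed

lemma upward_planar_3_treeI:
  assumes "upward_3_tree_faces V A F"
  shows "upward_planar_3_tree \<lparr>pverts = V, parcs = A\<rparr>"
proof -
  obtain p where "upward_drawing V A F p" using upward_3_tree_faces_drawing[OF assms] by blast
  then have "upward_planar_dag \<lparr>pverts = V, parcs = A\<rparr>"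
    using upward_3_tree_faces_arcs[OF assms] unfolding upward_drawing_def
    by (intro upward_planar_dagI) auto
  then show ?thesis
    using upward_3_tree_faces_planar[OF assms] by (auto simp: upward_planar_3_tree_def planar_3_tree_def)
qed

section \<open>Stack numbers along an insertion sequence\<close>

lemma stackable_triangle:
  assumes "a \<noteq> b" "b \<noteq> c" "a \<noteq> c"
  shows "stackable \<lparr>pverts = {a, b, c}, parcs = {(a, b), (b, c), (a, c)}\<rparr> (Suc k)"
proof -
  let ?r = "{(a, a), (b, b), (c, c), (a, b), (b, c), (a, c)}"
  have "linear_order_on {a, b, c} ?r"
    unfolding linear_order_on_def partial_order_on_def preorder_on_def
  proof (intro conjI)
    show "refl_on {a, b, c} ?r" by (auto simp: refl_on_def)
    show "trans ?r" by (rule transI) auto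
    show "antisym ?r" using assms by (intro antisymI) auto
    show "total_on {a, b, c} ?r" by (auto simp: total_on_def)
  qed auto
  moreover have "\<not> crosses ?r e f" if "e \<in> {(a, b), (b, c), (a, c)}" "f \<in> {(a, b), (b, c), (a, c)}" for e f
    using that by (auto simp: crosses_def)
  ultimately show ?thesis
    using assms unfolding stackable_def vertex_order_def before_def
    by (intro exI[of _ ?r] exI[of _ "\<lambda>_. 0"]) auto
qed

text \<open>Going back through the insertions, either the tree before the last one already lacks the
  layout and the induction hypothesis applies, or the last insertion is the one that raises the
  number. The triangle stops the descent.\<close>

lemma upward_planar_3_tree_stack_number:
  fixes V :: "'a set"
  assumes "upward_3_tree_faces V A F" "\<not> stackable \<lparr>pverts = V, parcs = A\<rparr> (Suc k)"
  shows "\<exists>G :: 'a pair_pre_digraph. upward_planar_3_tree G \<and> stack_number G = Suc (Suc k)"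
  using assms
proof induction
  case (triangle a b c)
  show ?case using triangle.prems stackable_triangle[OF triangle.hyps, of k] by contradiction
next
  case (low V A F a b c x)
  let ?G = "\<lparr>pverts = insert x V, parcs = A \<union> {(a, x), (x, b), (x, c)}\<rparr>"
  show ?case
  proof (cases "stackable \<lparr>pverts = V, parcs = A\<rparr> (Suc k)")
    case True
    have A: "A \<subseteq> V \<times> V" and arcs: "(a, b) \<in> A" "(b, c) \<in> A" "(a, c) \<in> A"
      using upward_3_tree_faces_arcs[OF low(1)] corner_arcs[OF low(1-3)] by blast+
    then have V: "{a} \<subseteq> V" "{b, c} \<subseteq> V" by auto
    \<comment> \<open>A low vertex has one in-neighbour, the lowest corner, whose arcs to the other
      two corners make room for \<open>x\<close>.\<close>
    have io: "{a} \<times> {b, c} \<subseteq> A" using arcs by auto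
    have "{a} \<times> {x} \<union> {x} \<times> {b, c} = {(a, x), (x, b), (x, c)}" by auto
    then have "stackable ?G (Suc (Suc k))"
      using stackable_insert_vertex[OF True A low(3) V io] by (simp only:)
    then have "stack_number ?G = Suc (Suc k)"
      using low.prems by (rule stack_number_eqI)
    then show ?thesis
      using upward_planar_3_treeI[OF upward_3_tree_faces.low[OF low(1-3)]]
      by (intro exI[of _ ?G] conjI)
  qed (rule low.IH)
next
  case (high V A F a b c x)
  let ?G = "\<lparr>pverts = insert x V, parcs = A \<union> {(a, x), (b, x), (x, c)}\<rparr>"
  show ?case
  proof (cases "stackable \<lparr>pverts = V, parcs = A\<rparr> (Suc k)")
    case True
    have A: "A \<subseteq> V \<times> V" and arcs: "(a, b) \<in> A" "(b, c) \<in> A" "(a, c) \<in> A"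
      using upward_3_tree_faces_arcs[OF high(1)] corner_arcs[OF high(1-3)] by blast+
    then have V: "{a, b} \<subseteq> V" "{c} \<subseteq> V" by auto
    have io: "{a, b} \<times> {c} \<subseteq> A" using arcs by auto
    have "{a, b} \<times> {x} \<union> {x} \<times> {c} = {(a, x), (b, x), (x, c)}" by auto
    then have "stackable ?G (Suc (Suc k))"
      using stackable_insert_vertex[OF True A high(3) V io] by (simp only:)
    then have "stack_number ?G = Suc (Suc k)"
      using high.prems by (rule stack_number_eqI)
    then show ?thesis
      using upward_planar_3_treeI[OF upward_3_tree_faces.high[OF high(1-3)]]
      by (intro exI[of _ ?G] conjI)
  qed (rule high.IH)
qed

section \<open>Replaying a list of insertions\<close>

text \<open>Executable construction of an upward 3-tree; \<open>None\<close> reports an insertion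
  into a triple that is not a current face, or of a vertex already present.\<close>

fun insert_vertices ::
  "'a list \<Rightarrow> ('a \<times> 'a) list \<Rightarrow> ('a \<times> 'a \<times> 'a) list \<Rightarrow> ('a \<times> 'a \<times> 'a \<times> 'a \<times> bool) list \<Rightarrow>
    ('a list \<times> ('a \<times> 'a) list) option" where
  "insert_vertices V A F [] = Some (V, A)"
| "insert_vertices V A F ((x, a, b, c, is_low) # ts) =
    (if (a, b, c) \<in> set F \<and> x \<notin> set V then
       if is_low
       then insert_vertices (x # V) ((a, x) # (x, b) # (x, c) # A)
         ((a, x, b) # (x, b, c) # (a, x, c) # removeAll (a, b, c) F) ts
       else insert_vertices (x # V) ((a, x) # (b, x) # (x, c) # A)
         ((a, b, x) # (b, x, c) # (a, x, c) # removeAll (a, b, c) F) ts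
     else None)"

lemma insert_vertices_faces:
  assumes "upward_3_tree_faces (set V) (set A) (set F)" "insert_vertices V A F ts = Some (V', A')"
  shows "\<exists>F'. upward_3_tree_faces (set V') (set A') F'"
  using assms
proof (induction V A F ts rule: insert_vertices.induct)
  case (1 V A F)
  then show ?case by auto
next
  case (2 V A F x a b c is_low ts)
  then have face: "(a, b, c) \<in> set F" and x: "x \<notin> set V"
    by (auto split: if_splits)
  have arcs: "set A \<union> {(a, x), (x, b), (x, c)} = set ((a, x) # (x, b) # (x, c) # A)"
    "set A \<union> {(a, x), (b, x), (x, c)} = set ((a, x) # (b, x) # (x, c) # A)"
    and faces: "set F - {(a, b, c)} \<union> {(a, x, b), (x, b, c), (a, x, c)} =
      set ((a, x, b) # (x, b, c) # (a, x, c) # removeAll (a, b, c) F)"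
    "set F - {(a, b, c)} \<union> {(a, b, x), (b, x, c), (a, x, c)} =
      set ((a, b, x) # (b, x, c) # (a, x, c) # removeAll (a, b, c) F)"
    and verts: "insert x (set V) = set (x # V)"
    by auto
  show ?case
  proof (cases is_low)
    case True
    from upward_3_tree_faces.low[OF 2(3) face x]
    have "upward_3_tree_faces (set (x # V)) (set ((a, x) # (x, b) # (x, c) # A))
      (set ((a, x, b) # (x, b, c) # (a, x, c) # removeAll (a, b, c) F))"
      unfolding arcs faces verts .
    then show ?thesis using 2(1,4) face x True by simp
  next
    case False
    from upward_3_tree_faces.high[OF 2(3) face x]
    have "upward_3_tree_faces (set (x # V)) (set ((a, x) # (b, x) # (x, c) # A))
      (set ((a, b, x) # (b, x, c) # (a, x, c) # removeAll (a, b, c) F))"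
      unfolding arcs faces verts .
    then show ?thesis using 2(2,4) face x False by simp
  qed
qed

section \<open>The three graphs\<close>

text \<open>The graphs and the lists \<open>_triples\<close> and \<open>_crossings\<close> were found by computer search: the lists are taken from
  an unsatisfiable core of the propositional encoding. The vertices of the two outerplanar graphs are
  numbered along the layout whose stacks are listed.\<close>

definition st_stacks :: "(nat \<times> nat) list list" where
  "st_stacks =
    [[(2, 3), (3, 5), (4, 5), (5, 6)],
     [(0, 1), (0, 2), (0, 3), (4, 6)],
     [(1, 3), (1, 4), (1, 5)]]"

definition st_triples :: "(nat \<times> nat \<times> nat) list" where
  "st_triples =
    [(4, 0, 1), (6, 3, 5)]"

definition st_crossings :: "(nat \<times> nat \<times> nat \<times> nat) list" where
  "st_crossings =
    [(0, 3, 1, 4), (0, 3, 1, 5), (0, 3, 4, 6), (1, 4, 3, 5), (1, 5, 4, 6), (3, 5, 4, 6)]"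

abbreviation st_dag :: "nat pair_pre_digraph" where
  "st_dag \<equiv> \<lparr>pverts = {..<7}, parcs = set (concat st_stacks)\<rparr>"

text \<open>All depends on the order of 3 and 4. If 4 comes first, the arcs (0, 3), (1, 5), (4, 6)
  cross pairwise. Otherwise (0, 3), (1, 4), (3, 5), (4, 6), (1, 5) form a 5-cycle of crossings.
  Neither can be coloured with two stacks. The two triples supply that 0 precedes 4 and 3 precedes
  6.\<close>

lemma st_not_stackable: "\<not> stackable \<lparr>pverts = {..<7}, parcs = set (concat st_stacks)\<rparr> 2"
proof (rule not_stackableI[where es = "[(4, 6)]" and ks = "[0, 1]" and ts = st_triples and qs = st_crossings])
  fix p C
  note [simp del] = One_nat_def disj_not1
  \<comment> \<open>As a rewrite rule this leaves one atom per pair of vertices.\<close>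
  assume [simp]: "\<And>u v. u < v \<Longrightarrow> v < 7 \<Longrightarrow> p v u \<longleftrightarrow> \<not> p u v"
    and arcs: "list_all (\<lambda>(u, v). p u v) (concat st_stacks)"
    and stacks: "list_all (\<lambda>(u, v). list_ex (C u v) [0, 1]) (concat st_stacks)"
    and first: "list_all (\<lambda>(i, u, v). list_all (\<lambda>j. j \<le> i \<or> \<not> C u v j) [0, 1]) (List.enumerate 0 [(4, 6)])"
    and triples: "list_all (\<lambda>(u, v, w). \<not> p u v \<or> \<not> p v w \<or> p u w) st_triples"
    and crossings: "list_all (\<lambda>(a, b, c, d). list_all (\<lambda>i.
      \<not> C a b i \<or> \<not> C c d i \<or> \<not> p a c \<or> \<not> p c b \<or> \<not> p b d) [0, 1]) st_crossings"
  \<comment> \<open>The order along each arc is known, so its atom disappears from the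
    clauses.\<close>
  note [simp] = arcs[unfolded st_stacks_def concat.simps append.simps, simplified]
  show False
    using stacks[unfolded st_stacks_def concat.simps append.simps, simplified] first[simplified]
      triples[unfolded st_triples_def, simplified] crossings[unfolded st_crossings_def, simplified]
    using [[argo_timeout = 600]] by (elim conjE) argo
qed (code_simp, auto)

lemma st_stack_number: "stack_number st_dag = 3"
proof -
  have "length st_stacks = Suc 2" by (simp add: st_stacks_def)
  moreover have "stackable st_dag (length st_stacks)"
    by (rule stackableI; code_simp)
  ultimately have "stack_number st_dag = Suc 2"
    using stack_number_eqI st_not_stackable by metis
  then show ?thesis by simp
qed

lemma st_upward_outerplanar: "upward_outerplanar_dag st_dag"
proof -
  have "lattice_drawing 7 (concat st_stacks)
      [(3, 0), (1, 2), (4, 3), (7, 5), (3, 5), (6, 6), (1, 7)]"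
    by code_simp
  then have "upward_planar_dag st_dag"
    by (rule lattice_drawing_upward_planar) code_simp
  \<comment> \<open>Along the parabola the vertices read 4, 1, 0, 2, 3, 5, 6, the Hamiltonian outer
    cycle; the other four arcs are chords.\<close>
  moreover have "lattice_drawing 7 (concat st_stacks) (map (\<lambda>x. (x, x\<^sup>2))
      [-1, -2, 0, 1, -3, 2, 3])"
    by code_simp
  then have "outerplanar {..<7} (underlying_edges st_dag)"
    by (rule lattice_drawing_outerplanar) code_simp
  ultimately show ?thesis
    by (simp add: upward_outerplanar_dag_def outerplanar_dag_def upward_planar_dag_def)
qed

lemma single_sourceI:
  assumes "finite A" "{v \<in> V. v \<notin> snd ` A} = {s}"
  shows "single_source \<lparr>pverts = V, parcs = A\<rparr>"
proof -
  have "in_degree (with_proj \<lparr>pverts = V, parcs = A\<rparr>) v = card {e \<in> A. snd e = v}" for v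
    by (simp add: in_degree_def in_arcs_def)
  moreover have "{e \<in> A. snd e = v} = {} \<longleftrightarrow> v \<notin> snd ` A" for v by force
  ultimately have "in_degree (with_proj \<lparr>pverts = V, parcs = A\<rparr>) v = 0 \<longleftrightarrow> v \<notin> snd ` A" for v
    using assms(1) by simp
  moreover have "v \<in> V \<and> v \<notin> snd ` A \<longleftrightarrow> v = s" for v using assms(2) by blast
  ultimately show ?thesis by (simp add: single_source_def)
qed

lemma single_sinkI:
  assumes "finite A" "{v \<in> V. v \<notin> fst ` A} = {t}"
  shows "single_sink \<lparr>pverts = V, parcs = A\<rparr>"
proof -
  have "out_degree (with_proj \<lparr>pverts = V, parcs = A\<rparr>) v = card {e \<in> A. fst e = v}" for v
    by (simp add: out_degree_def out_arcs_def)
  moreover have "{e \<in> A. fst e = v} = {} \<longleftrightarrow> v \<notin> fst ` A" for v by force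
  ultimately have "out_degree (with_proj \<lparr>pverts = V, parcs = A\<rparr>) v = 0 \<longleftrightarrow> v \<notin> fst ` A" for v
    using assms(1) by simp
  moreover have "v \<in> V \<and> v \<notin> fst ` A \<longleftrightarrow> v = t" for v using assms(2) by blast
  ultimately show ?thesis by (simp add: single_sink_def)
qed

section \<open>The outerplanar graph with stack number 4\<close>

definition outer_stacks :: "(nat \<times> nat) list list" where
  "outer_stacks =
    [[(0, 3), (5, 20), (6, 7), (7, 20), (11, 13), (12, 13), (13, 16), (15, 16), (16, 19), (18, 19)],
     [(1, 17), (2, 5), (6, 15), (7, 15), (8, 15), (9, 10), (10, 11), (10, 13)],
     [(0, 1), (1, 3), (3, 17), (3, 21), (4, 7), (5, 7), (8, 17), (10, 12), (12, 15), (12, 16),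
      (13, 14), (17, 21)],
     [(1, 8), (2, 4), (4, 5), (4, 6), (6, 8), (8, 18), (9, 11), (11, 14), (15, 18), (17, 18)]]"

definition outer_triples :: "(nat \<times> nat \<times> nat) list" where
  "outer_triples =
    [(0, 1, 4), (0, 1, 6), (0, 1, 7), (0, 1, 8), (0, 1, 15), (0, 4, 5), (0, 6, 7), (0, 8, 12),
     (1, 3, 4), (1, 3, 6), (1, 3, 7), (1, 3, 12), (1, 4, 5), (1, 4, 6), (1, 6, 7), (1, 8, 7),
     (1, 8, 12), (1, 8, 13), (1, 8, 15), (1, 8, 20), (1, 12, 13), (1, 15, 16), (2, 4, 6),
     (2, 4, 8), (3, 4, 5), (3, 4, 8), (3, 5, 15), (3, 6, 7), (3, 6, 8), (3, 6, 15), (3, 7, 8),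
     (3, 8, 7), (3, 8, 13), (3, 8, 15), (3, 10, 12), (3, 12, 13), (3, 13, 6), (3, 15, 16),
     (3, 15, 20), (3, 17, 15), (3, 17, 18), (3, 18, 20), (4, 5, 12), (4, 5, 13), (4, 6, 8),
     (4, 6, 17), (5, 7, 15), (5, 7, 18), (5, 10, 12), (5, 12, 13), (5, 15, 13), (5, 15, 16),
     (6, 7, 13), (6, 7, 20), (6, 8, 10), (6, 8, 12), (6, 8, 13), (6, 8, 17), (6, 10, 11),
     (6, 10, 12), (6, 12, 13), (6, 15, 13), (6, 15, 16), (6, 17, 10), (6, 17, 12), (6, 17, 21),
     (7, 10, 12), (7, 12, 13), (7, 15, 13), (7, 15, 16), (7, 15, 18), (8, 5, 7), (8, 7, 20),
     (8, 10, 12), (8, 12, 7), (8, 12, 13), (8, 13, 7), (8, 15, 13), (8, 15, 14), (8, 15, 16),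
     (8, 15, 20), (8, 17, 5), (8, 17, 7), (8, 17, 12), (8, 17, 13), (8, 17, 21), (8, 21, 7),
     (9, 10, 12), (10, 12, 15), (10, 12, 18), (11, 13, 16), (12, 13, 14), (12, 15, 18),
     (13, 16, 19), (15, 11, 13), (15, 16, 14), (15, 18, 13), (17, 5, 15), (17, 7, 15),
     (17, 10, 12), (17, 12, 7), (17, 12, 13), (17, 12, 15), (17, 13, 15), (17, 15, 13),
     (17, 15, 16), (17, 15, 20), (17, 18, 13), (17, 18, 16), (17, 18, 19), (17, 18, 20),
     (17, 20, 15), (17, 21, 7), (17, 21, 12), (17, 21, 15), (18, 13, 16), (18, 14, 16),
     (20, 12, 15), (20, 13, 15), (20, 13, 16), (20, 13, 18), (20, 13, 19), (20, 15, 18),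
     (20, 16, 18), (20, 16, 19), (20, 18, 16), (20, 18, 19), (21, 7, 15), (21, 12, 15),
     (21, 13, 16), (21, 15, 18), (21, 16, 18), (21, 16, 19), (21, 18, 16), (21, 18, 19)]"

definition outer_crossings :: "(nat \<times> nat \<times> nat \<times> nat) list" where
  "outer_crossings =
    [(0, 1, 6, 8), (0, 1, 6, 15), (0, 1, 7, 20), (0, 3, 1, 8), (0, 3, 1, 17), (0, 3, 5, 7),
     (0, 3, 5, 20), (0, 3, 6, 15), (0, 3, 7, 20), (0, 3, 8, 15), (0, 3, 8, 17), (0, 3, 8, 18),
     (0, 3, 12, 15), (0, 3, 12, 16), (0, 3, 15, 18), (1, 3, 5, 20), (1, 3, 6, 15), (1, 3, 8, 17),
     (1, 3, 8, 18), (1, 8, 3, 17), (1, 8, 3, 21), (1, 8, 4, 7), (1, 8, 5, 20), (1, 8, 6, 15),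
     (1, 8, 7, 15), (1, 8, 7, 20), (1, 8, 12, 13), (1, 8, 12, 16), (1, 8, 13, 14), (1, 8, 13, 16),
     (1, 17, 3, 21), (1, 17, 5, 20), (1, 17, 6, 15), (1, 17, 7, 15), (1, 17, 7, 20),
     (1, 17, 8, 15), (1, 17, 8, 18), (1, 17, 12, 13), (1, 17, 12, 15), (1, 17, 12, 16),
     (1, 17, 13, 16), (1, 17, 15, 16), (1, 17, 15, 18), (1, 17, 16, 19), (2, 5, 4, 7),
     (2, 5, 6, 8), (2, 5, 6, 15), (2, 5, 8, 15), (2, 5, 8, 18), (3, 17, 5, 20), (3, 17, 6, 7),
     (3, 17, 6, 15), (3, 17, 8, 15), (3, 17, 8, 18), (3, 17, 12, 15), (3, 17, 12, 16),
     (3, 17, 13, 16), (3, 17, 15, 16), (3, 17, 15, 18), (3, 21, 6, 15), (3, 21, 7, 15),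
     (3, 21, 8, 15), (3, 21, 8, 18), (3, 21, 12, 15), (3, 21, 12, 16), (3, 21, 15, 16),
     (3, 21, 15, 18), (3, 21, 16, 19), (3, 21, 17, 18), (3, 21, 18, 19), (4, 6, 1, 3),
     (4, 6, 1, 8), (4, 6, 1, 17), (4, 6, 3, 17), (4, 6, 3, 21), (4, 6, 5, 7), (4, 6, 5, 20),
     (4, 6, 12, 13), (4, 6, 12, 15), (4, 6, 12, 16), (4, 6, 13, 16), (4, 7, 1, 3), (4, 7, 1, 17),
     (4, 7, 3, 21), (4, 7, 5, 20), (4, 7, 6, 8), (4, 7, 6, 15), (4, 7, 8, 15), (4, 7, 8, 17),
     (4, 7, 8, 18), (4, 7, 13, 16), (4, 7, 17, 18), (4, 7, 17, 21), (5, 7, 6, 8), (5, 7, 6, 15),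
     (5, 20, 1, 17), (5, 20, 6, 8), (5, 20, 6, 15), (5, 20, 7, 15), (5, 20, 8, 15), (5, 20, 8, 17),
     (5, 20, 8, 18), (5, 20, 12, 16), (5, 20, 15, 16), (5, 20, 16, 19), (5, 20, 17, 18),
     (5, 20, 18, 19), (6, 7, 8, 15), (6, 7, 8, 18), (6, 8, 0, 3), (6, 8, 1, 17), (6, 8, 3, 17),
     (6, 8, 3, 21), (6, 8, 7, 15), (6, 8, 7, 20), (6, 8, 12, 16), (6, 8, 13, 14), (6, 8, 13, 16),
     (6, 15, 1, 3), (6, 15, 1, 17), (6, 15, 3, 17), (6, 15, 3, 21), (6, 15, 7, 20), (6, 15, 8, 17),
     (6, 15, 8, 18), (6, 15, 10, 13), (6, 15, 11, 14), (6, 15, 12, 16), (6, 15, 13, 14),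
     (6, 15, 13, 16), (6, 15, 17, 18), (6, 15, 17, 21), (7, 15, 1, 17), (7, 15, 3, 17),
     (7, 15, 3, 21), (7, 15, 8, 17), (7, 15, 8, 18), (7, 15, 12, 16), (7, 15, 17, 18),
     (7, 15, 17, 21), (7, 20, 1, 17), (7, 20, 3, 17), (7, 20, 8, 15), (7, 20, 8, 17),
     (7, 20, 8, 18), (7, 20, 15, 18), (7, 20, 18, 19), (8, 15, 3, 17), (8, 15, 3, 21),
     (8, 15, 10, 13), (8, 15, 12, 16), (8, 15, 13, 14), (8, 15, 13, 16), (8, 15, 17, 18),
     (8, 15, 17, 21), (8, 17, 3, 21), (8, 17, 7, 15), (8, 17, 7, 20), (8, 17, 12, 13),
     (8, 17, 12, 15), (8, 17, 12, 16), (8, 17, 13, 16), (8, 17, 15, 16), (8, 17, 15, 18),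
     (8, 17, 16, 19), (8, 18, 3, 21), (8, 18, 7, 20), (8, 18, 12, 16), (8, 18, 13, 14),
     (8, 18, 13, 16), (8, 18, 15, 16), (8, 18, 16, 19), (8, 18, 17, 21), (9, 11, 10, 13),
     (9, 11, 12, 15), (9, 11, 12, 16), (10, 12, 6, 15), (10, 12, 8, 18), (10, 12, 17, 18),
     (10, 13, 3, 21), (10, 13, 5, 7), (10, 13, 5, 20), (10, 13, 6, 8), (10, 13, 7, 20),
     (10, 13, 8, 18), (10, 13, 11, 14), (10, 13, 12, 15), (10, 13, 12, 16), (10, 13, 15, 16),
     (10, 13, 15, 18), (10, 13, 17, 18), (10, 13, 17, 21), (10, 13, 18, 19), (11, 14, 12, 15),
     (11, 14, 13, 16), (11, 14, 15, 18), (12, 13, 7, 20), (12, 13, 15, 16), (12, 13, 17, 21),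
     (12, 15, 1, 17), (12, 15, 3, 21), (12, 15, 5, 20), (12, 15, 7, 20), (12, 15, 8, 17),
     (12, 15, 8, 18), (12, 15, 13, 14), (12, 15, 13, 16), (12, 15, 17, 18), (12, 15, 17, 21),
     (12, 16, 3, 21), (12, 16, 5, 20), (12, 16, 8, 18), (12, 16, 13, 14), (12, 16, 15, 18),
     (12, 16, 17, 18), (12, 16, 17, 21), (12, 16, 18, 19), (13, 14, 15, 16), (13, 16, 3, 21),
     (13, 16, 5, 20), (13, 16, 7, 20), (13, 16, 8, 18), (13, 16, 17, 21), (13, 16, 18, 19),
     (15, 16, 17, 18), (15, 16, 18, 19), (15, 18, 13, 16), (15, 18, 16, 19), (15, 18, 17, 21),
     (17, 18, 12, 16), (17, 18, 13, 16), (17, 18, 15, 16), (17, 18, 16, 19), (17, 21, 12, 16),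
     (17, 21, 15, 18), (17, 21, 18, 19)]"

abbreviation outer_dag :: "nat pair_pre_digraph" where
  "outer_dag \<equiv> \<lparr>pverts = {..<22}, parcs = set (concat outer_stacks)\<rparr>"

text \<open>The path 6 -> 8 -> 15 -> 18 makes (6, 15) and (8, 18) cross in every vertex order, so
  the numbering of stacks can put (8, 18) into stack 0 and (6, 15) into stack 1. With
  \<open>k\<close> stacks, bounds on \<open>k - 1\<close> arcs are all that such a numbering can
  offer.\<close>

lemma outer_not_stackable: "\<not> stackable \<lparr>pverts = {..<22}, parcs = set (concat outer_stacks)\<rparr> 3"
proof (rule not_stackableI[where es = "[(8, 18), (6, 15)]" and ks = "[0, 1, 2]" and ts = outer_triples and qs = outer_crossings])
  fix p C
  note [simp del] = One_nat_def disj_not1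
  assume [simp]: "\<And>u v. u < v \<Longrightarrow> v < 22 \<Longrightarrow> p v u \<longleftrightarrow> \<not> p u v"
    and arcs: "list_all (\<lambda>(u, v). p u v) (concat outer_stacks)"
    and stacks: "list_all (\<lambda>(u, v). list_ex (C u v) [0, 1, 2]) (concat outer_stacks)"
    and first: "list_all (\<lambda>(i, u, v). list_all (\<lambda>j. j \<le> i \<or> \<not> C u v j) [0, 1, 2]) (List.enumerate 0 [(8, 18), (6, 15)])"
    and triples: "list_all (\<lambda>(u, v, w). \<not> p u v \<or> \<not> p v w \<or> p u w) outer_triples"
    and crossings: "list_all (\<lambda>(a, b, c, d). list_all (\<lambda>i.
      \<not> C a b i \<or> \<not> C c d i \<or> \<not> p a c \<or> \<not> p c b \<or> \<not> p b d) [0, 1, 2]) outer_crossings"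
  note [simp] = arcs[unfolded outer_stacks_def concat.simps append.simps, simplified]
  show False
    using stacks[unfolded outer_stacks_def concat.simps append.simps, simplified] first[simplified]
      triples[unfolded outer_triples_def, simplified] crossings[unfolded outer_crossings_def, simplified]
    using [[argo_timeout = 600]] by (elim conjE) argo
qed (code_simp, auto)

lemma outer_stack_number: "stack_number outer_dag = 4"
proof -
  have "length outer_stacks = Suc 3" by (simp add: outer_stacks_def)
  moreover have "stackable outer_dag (length outer_stacks)"
    by (rule stackableI; code_simp)
  ultimately have "stack_number outer_dag = Suc 3"
    using stack_number_eqI outer_not_stackable by metis
  then show ?thesis by simp
qed

lemma outer_upward_outerplanar: "upward_outerplanar_dag outer_dag"
proof -
  have "lattice_drawing 22 (concat outer_stacks)
      [(24, 8), (27, 11), (59, 0), (16, 12), (42, 10), (33, 24), (24, 17), (27, 28), (20, 21),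
       (59, 6), (54, 20), (51, 38), (43, 30), (27, 47), (39, 59), (8, 47), (19, 51), (5, 22),
       (0, 52), (32, 59), (38, 32), (2, 24)]"
    by code_simp
  then have "upward_planar_dag outer_dag"
    by (rule lattice_drawing_upward_planar) code_simp
  \<comment> \<open>Again the abscissas follow a Hamiltonian outer cycle: 0, 3, 21, 17, 18, 19, 16,
    13, 14, 11, 9, 10, 12, 15, 7, 20, 5, 2, 4, 6, 8, 1.\<close>
  moreover have "lattice_drawing 22 (concat outer_stacks) (map (\<lambda>x. (x, x\<^sup>2))
      [-11, 10, 6, -10, 7, 5, 8, 3, 9, -1, 0, -2, 1, -4, -3, 2, -5, -8, -7, -6, 4, -9])"
    by code_simp
  then have "outerplanar {..<22} (underlying_edges outer_dag)"
    by (rule lattice_drawing_outerplanar) code_simp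
  ultimately show ?thesis
    by (simp add: upward_outerplanar_dag_def outerplanar_dag_def upward_planar_dag_def)
qed

section \<open>The planar 3-tree without a 4-stack layout\<close>

definition tree_insertions :: "(nat \<times> nat \<times> nat \<times> nat \<times> bool) list" where
  "tree_insertions =
    [(9, 0, 34, 36, True), (24, 0, 9, 34, False), (2, 0, 9, 36, True), (7, 0, 9, 24, True),
     (27, 9, 24, 34, False), (22, 0, 24, 34, True), (14, 9, 34, 36, True), (10, 2, 9, 36, False),
     (1, 0, 2, 36, True), (11, 7, 9, 24, False), (16, 0, 7, 24, False), (12, 9, 24, 27, True),
     (28, 24, 27, 34, False), (19, 9, 27, 34, True), (25, 22, 24, 34, False),
     (32, 0, 22, 34, False), (13, 9, 14, 34, True), (35, 14, 34, 36, False), (3, 2, 9, 10, True),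
     (4, 2, 10, 36, True), (5, 1, 2, 36, False), (8, 7, 9, 11, True), (6, 0, 7, 16, True),
     (17, 7, 16, 24, False), (15, 0, 16, 24, True), (26, 12, 24, 27, False), (18, 9, 19, 27, True),
     (29, 19, 27, 34, False), (20, 9, 19, 34, False), (23, 22, 24, 25, True),
     (30, 24, 25, 34, False), (21, 0, 22, 32, True), (33, 22, 32, 34, False),
     (31, 0, 32, 34, True)]"

text \<open>Arcs in the order in which \<open>insert_vertices\<close> returns them, latest insertion
  first, so that the result can be compared as a list.\<close>

definition tree_arcs :: "(nat \<times> nat) list" where
  "tree_arcs =
    [(0, 31), (31, 32), (31, 34), (22, 33), (32, 33), (33, 34), (0, 21), (21, 22), (21, 32),
     (24, 30), (25, 30), (30, 34), (22, 23), (23, 24), (23, 25), (9, 20), (19, 20), (20, 34),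
     (19, 29), (27, 29), (29, 34), (9, 18), (18, 19), (18, 27), (12, 26), (24, 26), (26, 27),
     (0, 15), (15, 16), (15, 24), (7, 17), (16, 17), (17, 24), (0, 6), (6, 7), (6, 16), (7, 8),
     (8, 9), (8, 11), (1, 5), (2, 5), (5, 36), (2, 4), (4, 10), (4, 36), (2, 3), (3, 9), (3, 10),
     (14, 35), (34, 35), (35, 36), (9, 13), (13, 14), (13, 34), (0, 32), (22, 32), (32, 34),
     (22, 25), (24, 25), (25, 34), (9, 19), (19, 27), (19, 34), (24, 28), (27, 28), (28, 34),
     (9, 12), (12, 24), (12, 27), (0, 16), (7, 16), (16, 24), (7, 11), (9, 11), (11, 24), (0, 1),
     (1, 2), (1, 36), (2, 10), (9, 10), (10, 36), (9, 14), (14, 34), (14, 36), (0, 22), (22, 24),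
     (22, 34), (9, 27), (24, 27), (27, 34), (0, 7), (7, 9), (7, 24), (0, 2), (2, 9), (2, 36),
     (0, 24), (9, 24), (24, 34), (0, 9), (9, 34), (9, 36), (0, 34), (34, 36), (0, 36)]"

definition tree_triples :: "(nat \<times> nat \<times> nat) list" where
  "tree_triples =
    [(0, 2, 3), (0, 2, 4), (0, 2, 10), (0, 7, 8), (0, 7, 11), (0, 9, 12), (0, 9, 13), (0, 9, 14),
     (0, 9, 18), (0, 9, 19), (0, 22, 23), (0, 24, 25), (0, 24, 27), (1, 2, 9), (1, 2, 22),
     (1, 2, 32), (1, 9, 24), (1, 9, 34), (1, 22, 7), (1, 22, 16), (2, 3, 7), (2, 3, 22), (2, 4, 7),
     (2, 7, 8), (2, 7, 16), (2, 9, 11), (2, 9, 14), (2, 9, 16), (2, 9, 22), (2, 9, 24), (2, 9, 32),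
     (2, 9, 34), (2, 11, 25), (2, 21, 7), (2, 21, 22), (2, 22, 7), (2, 22, 16), (2, 22, 23),
     (2, 22, 32), (2, 32, 7), (2, 32, 16), (3, 9, 4), (3, 9, 11), (3, 9, 14), (3, 9, 19),
     (3, 9, 22), (3, 9, 24), (3, 9, 32), (3, 9, 34), (3, 22, 32), (3, 24, 4), (4, 7, 16),
     (4, 9, 11), (4, 9, 22), (4, 9, 24), (4, 9, 34), (4, 10, 22), (4, 10, 24), (4, 10, 27),
     (4, 10, 34), (4, 14, 34), (4, 22, 24), (4, 22, 32), (4, 24, 19), (4, 24, 27), (4, 24, 32),
     (4, 24, 34), (4, 24, 35), (4, 32, 24), (4, 32, 34), (4, 34, 35), (6, 7, 9), (6, 7, 15),
     (7, 9, 10), (7, 9, 12), (7, 9, 14), (7, 9, 18), (7, 9, 19), (7, 9, 22), (7, 9, 23),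
     (7, 9, 32), (7, 9, 34), (7, 9, 36), (7, 16, 21), (7, 16, 22), (7, 16, 32), (7, 21, 22),
     (7, 22, 32), (7, 24, 25), (7, 32, 33), (9, 10, 16), (9, 10, 21), (9, 10, 22), (9, 10, 32),
     (9, 11, 16), (9, 11, 21), (9, 11, 22), (9, 11, 32), (9, 12, 16), (9, 12, 21), (9, 12, 22),
     (9, 13, 22), (9, 14, 21), (9, 14, 22), (9, 14, 32), (9, 15, 16), (9, 16, 17), (9, 16, 22),
     (9, 18, 22), (9, 19, 21), (9, 19, 22), (9, 19, 23), (9, 21, 22), (9, 22, 15), (9, 22, 16),
     (9, 22, 23), (9, 22, 32), (9, 23, 32), (9, 24, 25), (9, 24, 32), (9, 25, 32), (9, 32, 15),
     (9, 32, 16), (9, 32, 33), (10, 11, 24), (10, 12, 23), (10, 14, 34), (10, 15, 16),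
     (10, 16, 17), (10, 16, 24), (10, 19, 25), (10, 22, 24), (10, 22, 27), (10, 22, 32),
     (10, 22, 34), (10, 24, 14), (10, 24, 19), (10, 24, 27), (10, 24, 32), (10, 24, 34),
     (10, 25, 32), (10, 32, 24), (10, 32, 27), (10, 32, 33), (10, 32, 34), (10, 34, 35),
     (11, 15, 16), (11, 22, 12), (11, 22, 19), (11, 24, 14), (11, 24, 19), (11, 24, 25),
     (11, 24, 27), (11, 24, 32), (11, 24, 34), (11, 32, 12), (11, 32, 19), (11, 32, 23),
     (11, 34, 36), (12, 21, 22), (12, 24, 14), (12, 24, 19), (12, 24, 20), (12, 24, 25),
     (12, 24, 32), (12, 24, 33), (12, 24, 34), (12, 27, 36), (12, 32, 33), (13, 14, 22),
     (13, 14, 24), (13, 14, 32), (13, 22, 27), (13, 24, 27), (13, 32, 24), (13, 32, 33),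
     (14, 16, 24), (14, 19, 24), (14, 19, 25), (14, 19, 27), (14, 22, 24), (14, 22, 27),
     (14, 22, 32), (14, 24, 27), (14, 24, 32), (14, 32, 27), (16, 24, 19), (16, 24, 25),
     (16, 24, 26), (16, 24, 27), (16, 24, 32), (16, 24, 34), (16, 34, 36), (17, 24, 27),
     (17, 24, 34), (17, 34, 36), (18, 19, 24), (18, 22, 32), (18, 24, 25), (19, 20, 24),
     (19, 21, 24), (19, 22, 24), (19, 23, 24), (19, 24, 25), (19, 24, 32), (19, 24, 33),
     (19, 25, 30), (19, 25, 32), (19, 27, 25), (19, 27, 28), (19, 27, 30), (19, 27, 32),
     (19, 27, 33), (19, 28, 25), (19, 28, 33), (19, 32, 24), (19, 34, 36), (20, 22, 24),
     (20, 27, 29), (20, 32, 24), (21, 22, 24), (21, 22, 27), (22, 24, 26), (22, 24, 27),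
     (22, 24, 29), (22, 34, 36), (23, 24, 27), (23, 24, 32), (23, 24, 34), (23, 25, 36),
     (23, 32, 33), (24, 25, 32), (24, 27, 29), (24, 27, 32), (24, 29, 32), (24, 32, 33),
     (24, 34, 35), (24, 34, 36), (25, 27, 28), (25, 27, 29), (25, 27, 32), (25, 30, 27),
     (25, 30, 32), (25, 34, 36), (26, 27, 28), (26, 27, 34), (27, 28, 32), (27, 32, 33),
     (27, 34, 36), (32, 34, 36), (33, 34, 36)]"

definition tree_crossings :: "(nat \<times> nat \<times> nat \<times> nat) list" where
  "tree_crossings =
    [(0, 2, 1, 36), (0, 2, 7, 9), (0, 2, 7, 11), (0, 2, 7, 24), (0, 2, 16, 24), (0, 2, 21, 32),
     (0, 2, 22, 24), (0, 2, 22, 34), (0, 7, 2, 9), (0, 7, 2, 10), (0, 7, 2, 36), (0, 7, 4, 36),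
     (0, 7, 6, 16), (0, 7, 15, 24), (0, 7, 21, 22), (0, 7, 21, 32), (0, 7, 22, 24), (0, 7, 22, 25),
     (0, 7, 22, 34), (0, 9, 1, 36), (0, 9, 2, 4), (0, 9, 2, 10), (0, 9, 2, 36), (0, 9, 3, 10),
     (0, 9, 4, 10), (0, 9, 4, 36), (0, 9, 6, 16), (0, 9, 7, 11), (0, 9, 7, 17), (0, 9, 7, 24),
     (0, 9, 8, 11), (0, 9, 16, 24), (0, 9, 21, 22), (0, 9, 21, 32), (0, 9, 22, 23), (0, 9, 22, 24),
     (0, 9, 22, 25), (0, 9, 22, 34), (0, 9, 32, 34), (0, 15, 6, 16), (0, 15, 7, 9), (0, 15, 7, 11),
     (0, 15, 7, 24), (0, 16, 1, 2), (0, 16, 2, 9), (0, 16, 2, 10), (0, 16, 2, 36), (0, 16, 4, 36),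
     (0, 16, 7, 9), (0, 16, 7, 11), (0, 16, 7, 17), (0, 16, 7, 24), (0, 16, 9, 19), (0, 16, 9, 24),
     (0, 16, 9, 27), (0, 16, 9, 34), (0, 16, 9, 36), (0, 16, 12, 26), (0, 16, 21, 32),
     (0, 16, 22, 24), (0, 16, 22, 25), (0, 16, 22, 32), (0, 16, 22, 34), (0, 16, 32, 34),
     (0, 22, 1, 36), (0, 22, 2, 4), (0, 22, 2, 9), (0, 22, 2, 10), (0, 22, 2, 36), (0, 22, 3, 10),
     (0, 22, 4, 10), (0, 22, 4, 36), (0, 22, 7, 11), (0, 22, 7, 24), (0, 22, 9, 10),
     (0, 22, 9, 12), (0, 22, 9, 14), (0, 22, 9, 19), (0, 22, 9, 24), (0, 22, 9, 27),
     (0, 22, 9, 34), (0, 22, 9, 36), (0, 22, 10, 36), (0, 22, 11, 24), (0, 22, 12, 27),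
     (0, 22, 13, 34), (0, 22, 15, 24), (0, 22, 16, 24), (0, 22, 19, 29), (0, 22, 21, 32),
     (0, 24, 1, 36), (0, 24, 2, 4), (0, 24, 2, 10), (0, 24, 2, 36), (0, 24, 3, 10), (0, 24, 4, 10),
     (0, 24, 4, 36), (0, 24, 9, 10), (0, 24, 9, 14), (0, 24, 9, 19), (0, 24, 9, 20),
     (0, 24, 9, 27), (0, 24, 9, 34), (0, 24, 9, 36), (0, 24, 10, 36), (0, 24, 12, 26),
     (0, 24, 12, 27), (0, 24, 13, 34), (0, 24, 14, 36), (0, 24, 18, 27), (0, 24, 19, 29),
     (0, 24, 19, 34), (0, 24, 21, 32), (0, 24, 22, 25), (0, 24, 22, 32), (0, 24, 22, 33),
     (0, 24, 22, 34), (0, 24, 23, 25), (0, 24, 32, 33), (0, 24, 32, 34), (0, 32, 1, 36),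
     (0, 32, 2, 4), (0, 32, 2, 9), (0, 32, 2, 10), (0, 32, 2, 36), (0, 32, 3, 10), (0, 32, 4, 10),
     (0, 32, 4, 36), (0, 32, 7, 9), (0, 32, 7, 11), (0, 32, 7, 16), (0, 32, 7, 24), (0, 32, 9, 12),
     (0, 32, 9, 19), (0, 32, 9, 20), (0, 32, 9, 24), (0, 32, 9, 27), (0, 32, 9, 34),
     (0, 32, 9, 36), (0, 32, 10, 36), (0, 32, 11, 24), (0, 32, 13, 34), (0, 32, 14, 36),
     (0, 32, 15, 24), (0, 32, 16, 24), (0, 32, 18, 19), (0, 32, 19, 34), (0, 32, 22, 23),
     (0, 32, 22, 24), (0, 32, 22, 25), (0, 32, 22, 33), (0, 32, 22, 34), (0, 32, 24, 28),
     (0, 32, 24, 34), (0, 32, 25, 34), (0, 32, 27, 34), (0, 34, 1, 36), (0, 34, 2, 10),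
     (0, 34, 2, 36), (0, 34, 3, 10), (0, 34, 4, 36), (0, 34, 9, 36), (0, 34, 10, 36),
     (0, 34, 14, 35), (0, 34, 14, 36), (1, 2, 7, 9), (1, 2, 7, 11), (1, 2, 16, 24), (1, 2, 21, 32),
     (1, 2, 22, 32), (1, 2, 22, 34), (2, 4, 3, 10), (2, 4, 9, 14), (2, 4, 9, 24), (2, 4, 9, 27),
     (2, 4, 9, 36), (2, 4, 14, 36), (2, 4, 22, 34), (2, 9, 3, 10), (2, 9, 4, 36), (2, 9, 7, 11),
     (2, 9, 7, 24), (2, 9, 8, 11), (2, 9, 16, 24), (2, 9, 21, 32), (2, 9, 22, 23), (2, 9, 22, 24),
     (2, 9, 22, 25), (2, 9, 22, 32), (2, 9, 22, 34), (2, 9, 23, 25), (2, 9, 32, 34),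
     (2, 10, 4, 36), (2, 10, 7, 11), (2, 10, 7, 24), (2, 10, 9, 12), (2, 10, 9, 14),
     (2, 10, 9, 24), (2, 10, 9, 27), (2, 10, 9, 34), (2, 10, 9, 36), (2, 10, 14, 36),
     (2, 10, 16, 24), (2, 10, 22, 23), (2, 10, 22, 24), (2, 10, 22, 25), (2, 10, 22, 32),
     (2, 10, 22, 34), (2, 10, 23, 24), (2, 10, 24, 34), (2, 10, 25, 34), (2, 10, 32, 34),
     (3, 10, 4, 36), (3, 10, 9, 14), (3, 10, 9, 24), (3, 10, 9, 27), (3, 10, 9, 34),
     (3, 10, 9, 36), (3, 10, 14, 36), (3, 10, 19, 34), (4, 10, 9, 24), (4, 10, 9, 36),
     (4, 10, 14, 36), (6, 16, 7, 9), (6, 16, 7, 11), (6, 16, 7, 17), (6, 16, 7, 24),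
     (6, 16, 9, 14), (6, 16, 9, 24), (6, 16, 9, 27), (6, 16, 9, 34), (6, 16, 9, 36), (7, 9, 2, 10),
     (7, 9, 2, 36), (7, 9, 3, 10), (7, 9, 4, 36), (7, 9, 8, 11), (7, 9, 16, 24), (7, 9, 22, 34),
     (7, 11, 2, 10), (7, 11, 2, 36), (7, 11, 3, 10), (7, 11, 4, 10), (7, 11, 9, 14),
     (7, 11, 9, 19), (7, 11, 9, 24), (7, 11, 9, 27), (7, 11, 9, 34), (7, 11, 9, 36),
     (7, 11, 10, 36), (7, 11, 16, 24), (7, 11, 21, 22), (7, 11, 22, 24), (7, 11, 22, 32),
     (7, 11, 22, 34), (7, 11, 32, 34), (7, 16, 2, 9), (7, 16, 2, 10), (7, 16, 2, 36),
     (7, 17, 9, 24), (7, 17, 9, 27), (7, 17, 9, 34), (7, 17, 9, 36), (7, 17, 10, 36),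
     (7, 17, 16, 24), (7, 24, 1, 36), (7, 24, 2, 4), (7, 24, 2, 10), (7, 24, 2, 36),
     (7, 24, 4, 36), (7, 24, 9, 10), (7, 24, 9, 14), (7, 24, 9, 19), (7, 24, 9, 20),
     (7, 24, 9, 27), (7, 24, 9, 34), (7, 24, 9, 36), (7, 24, 10, 36), (7, 24, 12, 26),
     (7, 24, 12, 27), (7, 24, 14, 36), (7, 24, 18, 27), (7, 24, 19, 29), (7, 24, 19, 34),
     (7, 24, 21, 32), (7, 24, 22, 25), (7, 24, 22, 32), (7, 24, 22, 33), (7, 24, 22, 34),
     (7, 24, 23, 25), (7, 24, 32, 33), (7, 24, 32, 34), (8, 11, 9, 24), (8, 11, 9, 27),
     (8, 11, 9, 34), (8, 11, 9, 36), (9, 10, 4, 36), (9, 10, 14, 36), (9, 12, 10, 36),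
     (9, 12, 11, 24), (9, 12, 16, 24), (9, 12, 21, 32), (9, 12, 22, 23), (9, 12, 22, 24),
     (9, 12, 22, 25), (9, 12, 22, 32), (9, 12, 22, 34), (9, 12, 23, 24), (9, 12, 23, 25),
     (9, 14, 10, 36), (9, 14, 12, 27), (9, 14, 19, 34), (9, 14, 22, 34), (9, 14, 24, 34),
     (9, 14, 25, 34), (9, 14, 27, 34), (9, 14, 32, 34), (9, 19, 4, 36), (9, 19, 10, 36),
     (9, 19, 11, 24), (9, 19, 12, 27), (9, 19, 14, 36), (9, 19, 18, 27), (9, 19, 21, 32),
     (9, 19, 22, 24), (9, 19, 22, 34), (9, 19, 23, 25), (9, 19, 24, 27), (9, 19, 24, 28),
     (9, 19, 24, 30), (9, 19, 24, 34), (9, 19, 25, 34), (9, 19, 32, 34), (9, 19, 33, 34),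
     (9, 20, 19, 34), (9, 20, 22, 34), (9, 20, 24, 34), (9, 20, 27, 34), (9, 24, 4, 36),
     (9, 24, 10, 36), (9, 24, 12, 26), (9, 24, 12, 27), (9, 24, 13, 34), (9, 24, 14, 36),
     (9, 24, 18, 27), (9, 24, 19, 29), (9, 24, 19, 34), (9, 24, 21, 32), (9, 24, 22, 25),
     (9, 24, 22, 32), (9, 24, 22, 33), (9, 24, 22, 34), (9, 24, 23, 25), (9, 24, 32, 34),
     (9, 27, 4, 36), (9, 27, 10, 36), (9, 27, 13, 34), (9, 27, 14, 36), (9, 27, 19, 29),
     (9, 27, 19, 34), (9, 27, 20, 34), (9, 27, 21, 32), (9, 27, 22, 25), (9, 27, 22, 32),
     (9, 27, 22, 33), (9, 27, 22, 34), (9, 27, 23, 25), (9, 27, 24, 25), (9, 27, 24, 28),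
     (9, 27, 24, 30), (9, 27, 24, 34), (9, 27, 25, 34), (9, 27, 32, 33), (9, 27, 32, 34),
     (9, 34, 4, 10), (9, 34, 4, 36), (9, 34, 10, 36), (9, 34, 14, 35), (9, 34, 14, 36),
     (11, 24, 12, 26), (11, 24, 22, 25), (11, 24, 22, 32), (11, 24, 22, 34), (11, 24, 32, 33),
     (11, 24, 32, 34), (12, 26, 22, 34), (12, 26, 24, 27), (12, 26, 24, 28), (12, 26, 24, 34),
     (12, 27, 10, 36), (12, 27, 14, 36), (12, 27, 19, 29), (12, 27, 19, 34), (12, 27, 20, 34),
     (12, 27, 22, 34), (12, 27, 24, 25), (12, 27, 24, 28), (12, 27, 24, 30), (12, 27, 24, 34),
     (12, 27, 25, 34), (12, 27, 32, 33), (12, 27, 32, 34), (12, 27, 33, 34), (13, 34, 14, 36),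
     (14, 35, 4, 36), (14, 35, 10, 36), (15, 24, 9, 27), (15, 24, 10, 36), (15, 24, 22, 34),
     (16, 24, 1, 36), (16, 24, 2, 10), (16, 24, 4, 10), (16, 24, 9, 19), (16, 24, 9, 27),
     (16, 24, 9, 34), (16, 24, 9, 36), (16, 24, 10, 36), (16, 24, 12, 26), (16, 24, 12, 27),
     (16, 24, 22, 34), (18, 19, 22, 23), (18, 19, 22, 25), (18, 19, 22, 34), (18, 27, 19, 29),
     (18, 27, 19, 34), (18, 27, 22, 33), (18, 27, 24, 28), (18, 27, 24, 34), (19, 29, 20, 34),
     (19, 29, 22, 34), (19, 29, 24, 34), (19, 29, 25, 34), (19, 29, 27, 34), (19, 29, 32, 34),
     (19, 34, 14, 36), (21, 22, 7, 24), (21, 22, 9, 12), (21, 22, 9, 24), (21, 22, 9, 27),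
     (21, 22, 9, 34), (21, 22, 9, 36), (21, 22, 10, 36), (21, 32, 1, 36), (21, 32, 2, 10),
     (21, 32, 2, 36), (21, 32, 7, 24), (21, 32, 9, 10), (21, 32, 9, 14), (21, 32, 9, 19),
     (21, 32, 9, 24), (21, 32, 9, 27), (21, 32, 9, 34), (21, 32, 9, 36), (21, 32, 10, 36),
     (21, 32, 12, 27), (21, 32, 14, 36), (21, 32, 19, 34), (21, 32, 22, 23), (21, 32, 22, 24),
     (21, 32, 22, 25), (21, 32, 22, 33), (21, 32, 22, 34), (21, 32, 24, 30), (21, 32, 24, 34),
     (21, 32, 27, 34), (22, 23, 7, 24), (22, 23, 9, 24), (22, 23, 9, 27), (22, 23, 9, 34),
     (22, 23, 9, 36), (22, 23, 11, 24), (22, 23, 32, 34), (22, 24, 2, 10), (22, 24, 2, 36),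
     (22, 24, 3, 10), (22, 24, 9, 10), (22, 24, 9, 14), (22, 24, 9, 19), (22, 24, 9, 27),
     (22, 24, 9, 34), (22, 24, 9, 36), (22, 24, 10, 36), (22, 24, 12, 26), (22, 24, 12, 27),
     (22, 24, 13, 34), (22, 24, 14, 36), (22, 24, 18, 27), (22, 24, 19, 29), (22, 24, 19, 34),
     (22, 24, 23, 25), (22, 24, 32, 33), (22, 24, 32, 34), (22, 25, 2, 10), (22, 25, 2, 36),
     (22, 25, 9, 14), (22, 25, 9, 34), (22, 25, 9, 36), (22, 25, 10, 36), (22, 25, 12, 27),
     (22, 25, 14, 36), (22, 25, 18, 27), (22, 25, 19, 29), (22, 25, 19, 34), (22, 25, 24, 27),
     (22, 25, 24, 28), (22, 25, 24, 30), (22, 25, 24, 34), (22, 25, 27, 34), (22, 25, 32, 34),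
     (22, 25, 33, 34), (22, 32, 2, 10), (22, 32, 2, 36), (22, 32, 7, 9), (22, 32, 7, 11),
     (22, 32, 7, 24), (22, 32, 9, 14), (22, 32, 9, 27), (22, 32, 9, 34), (22, 32, 9, 36),
     (22, 32, 12, 27), (22, 32, 19, 34), (22, 32, 27, 34), (22, 33, 7, 24), (22, 33, 9, 34),
     (22, 33, 9, 36), (22, 33, 10, 36), (22, 33, 12, 27), (22, 33, 13, 34), (22, 33, 19, 34),
     (22, 33, 23, 25), (22, 33, 24, 34), (22, 33, 25, 34), (22, 33, 27, 34), (22, 33, 32, 34),
     (22, 34, 1, 36), (22, 34, 2, 36), (22, 34, 3, 10), (22, 34, 4, 10), (22, 34, 4, 36),
     (22, 34, 9, 10), (22, 34, 9, 36), (22, 34, 10, 36), (22, 34, 14, 35), (22, 34, 14, 36),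
     (23, 24, 10, 36), (23, 24, 12, 26), (23, 25, 9, 14), (23, 25, 9, 34), (23, 25, 9, 36),
     (23, 25, 12, 27), (23, 25, 19, 34), (23, 25, 24, 27), (23, 25, 24, 30), (23, 25, 24, 34),
     (23, 25, 27, 34), (23, 25, 32, 34), (24, 25, 19, 34), (24, 25, 32, 33), (24, 27, 14, 36),
     (24, 27, 19, 29), (24, 27, 19, 34), (24, 27, 20, 34), (24, 28, 19, 34), (24, 28, 25, 34),
     (24, 28, 27, 34), (24, 28, 32, 34), (24, 28, 33, 34), (24, 30, 19, 34), (24, 30, 32, 34),
     (24, 34, 4, 10), (24, 34, 4, 36), (24, 34, 10, 36), (24, 34, 14, 35), (24, 34, 14, 36),
     (25, 34, 14, 36), (27, 34, 14, 36), (32, 33, 19, 34), (32, 34, 2, 36), (32, 34, 4, 36),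
     (32, 34, 9, 10), (32, 34, 9, 36), (32, 34, 10, 36), (32, 34, 14, 36)]"

lemma tree_faces: "\<exists>F. upward_3_tree_faces {..<37} (set tree_arcs) F"
proof -
  let ?V = "[0, 34, 36]"
    and ?A = "[(0, 34), (34, 36), (0, 36)] :: (nat \<times> nat) list" and ?F = "[(0, 34, 36)]"
  have "upward_3_tree_faces (set ?V) (set ?A) (set ?F)"
    using upward_3_tree_faces.triangle[of "0 :: nat" 34 36] by simp
  moreover have "(case insert_vertices ?V ?A ?F tree_insertions of
      Some (V, A) \<Rightarrow> set V = set [0..<37] \<and> A = tree_arcs | None \<Rightarrow> False)"
    by code_simp
  then obtain V where "insert_vertices ?V ?A ?F tree_insertions = Some (V, tree_arcs)" "set V = {..<37}"
    by (auto split: option.splits simp: atLeast0LessThan)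
  ultimately show ?thesis using insert_vertices_faces by metis
qed

text \<open>The paths 0 -> 22 -> 24 -> 34 and 0 -> 9 -> 24 -> 34 -> 36 make (0, 24) cross both (22,
  34) and (9, 36) in every vertex order. Numbering the stacks with (22, 34) in stack 0 therefore
  forces (0, 24) into stack 1 and leaves stacks 0 and 2 for (9, 36).\<close>

lemma tree_not_stackable: "\<not> stackable \<lparr>pverts = {..<37}, parcs = set tree_arcs\<rparr> 4"
proof (rule not_stackableI[where es = "[(22, 34), (0, 24), (9, 36)]" and ks = "[0, 1, 2, 3]" and ts = tree_triples and qs = tree_crossings])
  fix p C
  note [simp del] = One_nat_def disj_not1
  assume [simp]: "\<And>u v. u < v \<Longrightarrow> v < 37 \<Longrightarrow> p v u \<longleftrightarrow> \<not> p u v"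
    and arcs: "list_all (\<lambda>(u, v). p u v) tree_arcs"
    and stacks: "list_all (\<lambda>(u, v). list_ex (C u v) [0, 1, 2, 3]) tree_arcs"
    and first: "list_all (\<lambda>(i, u, v). list_all (\<lambda>j. j \<le> i \<or> \<not> C u v j) [0, 1, 2, 3]) (List.enumerate 0 [(22, 34), (0, 24), (9, 36)])"
    and triples: "list_all (\<lambda>(u, v, w). \<not> p u v \<or> \<not> p v w \<or> p u w) tree_triples"
    and crossings: "list_all (\<lambda>(a, b, c, d). list_all (\<lambda>i.
      \<not> C a b i \<or> \<not> C c d i \<or> \<not> p a c \<or> \<not> p c b \<or> \<not> p b d) [0, 1, 2, 3]) tree_crossings"
  note [simp] = arcs[unfolded tree_arcs_def, simplified]
  show False
    using stacks[unfolded tree_arcs_def, simplified] first[simplified]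
      triples[unfolded tree_triples_def, simplified] crossings[unfolded tree_crossings_def, simplified]
    using [[argo_timeout = 600]] by (elim conjE) argo
qed (code_simp, auto)

theorem theorem3:
  shows "(\<exists>G :: nat pair_pre_digraph.
            upward_outerplanar_dag G \<and> single_source G \<and> single_sink G \<and> stack_number G = 3) \<and>
         (\<exists>G :: nat pair_pre_digraph. upward_outerplanar_dag G \<and> stack_number G = 4) \<and>
         (\<exists>G :: nat pair_pre_digraph. upward_planar_3_tree G \<and> stack_number G = 5)"
proof (intro conjI)
  \<comment> \<open>As a filtered list the set of sources can be evaluated.\<close>
  have "{v \<in> {..<7}. v \<notin> snd ` set (concat st_stacks)} = set (filter (\<lambda>v. v \<notin> snd ` set (concat st_stacks)) [0..<7])"
    by auto
  also have "\<dots> = {0}" by code_simp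
  finally have "single_source st_dag" by (intro single_sourceI) auto
  have "{v \<in> {..<7}. v \<notin> fst ` set (concat st_stacks)} = set (filter (\<lambda>v. v \<notin> fst ` set (concat st_stacks)) [0..<7])"
    by auto
  also have "\<dots> = {6}" by code_simp
  finally have "single_sink st_dag" by (intro single_sinkI) auto
  with \<open>single_source st_dag\<close>
  show "\<exists>G :: nat pair_pre_digraph. upward_outerplanar_dag G \<and> single_source G \<and> single_sink G \<and> stack_number G = 3"
    using st_upward_outerplanar st_stack_number by blast
  show "\<exists>G :: nat pair_pre_digraph. upward_outerplanar_dag G \<and> stack_number G = 4"
    using outer_upward_outerplanar outer_stack_number by blast
  obtain F where "upward_3_tree_faces {..<37} (set tree_arcs) F" using tree_faces ..
  then show "\<exists>G :: nat pair_pre_digraph. upward_planar_3_tree G \<and> stack_number G = 5"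
    \<comment> \<open>With \<open>k = 3\<close> the refuted number \<open>Suc k\<close> is 4 and the
      stack number \<open>Suc (Suc k)\<close> is 5.\<close>
    using upward_planar_3_tree_stack_number[of "{..<37}" "set tree_arcs" F 3] tree_not_stackable by simp
qed

end
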